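(* Let $A=\mathbb{K}[X_1][X_2;\sigma_2,\delta_2]\cdots[X_N;\sigma_N,\delta_N]$ be a quantum nilpotent algebra with parameter matrix $\Lambda=(\lambda_{i,j})$, and let $A^{(2)}\subseteq\mathrm{Frac}(A)$ be the algebra obtained at the end of the deleting derivations algorithm. Then $A':=A^{(2)}$ is a quantum affine space. More precisely, setting $T_i:=X_i^{(2)}$ for $i\in[\![1,N]\!]$, we have $A'=\mathbb{K}_\Lambda[T_1,\dots,T_N]$.
   Context: Notation: $\mathbb{K}$ is a field; $[\![a,b]\!]$ is the set of integers from $a$ to $b$. $\mathbb{K}_\Lambda[T_1,\dots,T_N]$ is the quantum affine space: the algebra generated by $T_1,\dots,T_N$ with defining relations $T_iT_j=\lambda_{i,j}T_jT_i$ (so the ordered monomials form a $\mathbb{K}$-basis). Ore extensions: in $R[x;\sigma,\delta]$, $\sigma$ is a $\mathbb{K}$-algebra automorphism of $R$, $\delta$ is a $\mathbb{K}$-linear $\sigma$-derivation, $\delta(ab)=\sigma(a)\delta(b)+\delta(a)b$, and $xr=\sigma(r)x+\delta(r)$. Higher skew derivations: for $1\ne q\in\mathbb{K}^*$, $\delta$ extends to a higher $q$-skew $\sigma$-derivation $\{d_n\}_{n\ge0}$ on $R$ if the $d_n$ are $\mathbb{K}$-linear operators on $R$ with $d_0=\mathrm{id}$, $d_1=\delta$, $d_n(rs)=\sum_{i=0}^n\sigma^{n-i}d_i(r)\,d_{n-i}(s)$ and $d_n\circ\sigma=q^n\sigma\circ d_n$ for all $n$. It is locally nilpotent if for each $r\in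 R$ there is $n_r\ge0$ with $d_n(r)=0$ for all $n\ge n_r$, and iterative if $d_nd_m=\binom{n+m}{m}_q d_{n+m}$ for all $n,m$. Quantum nilpotent algebra: $A=\mathbb{K}[X_1][X_2;\sigma_2,\delta_2]\cdots[X_N;\sigma_N,\delta_N]$ with $A_{i}=\mathbb{K}\langle X_1,\dots,X_i\rangle$ such that: (1) $\sigma_i(X_l)=\lambda_{i,l}X_l$ for $l<i$, $\lambda_{i,l}\in\mathbb{K}^*$; (2) $\Lambda=(\lambda_{i,j})\in M_N(\mathbb{K}^* )$ is multiplicatively antisymmetric ($\lambda_{i,l}=\lambda_{l,i}^{-1}$, $\lambda_{i,i}=1$); (3) for $2\le i\le N$ there is $1\ne q_i\in\mathbb{K}^*$ with $\delta_i\circ\sigma_i=q_i\sigma_i\circ\delta_i$; (4) for $2\le i\le N$, $\delta_i$ extends to a (fixed) locally nilpotent, iterative higher $q_i$-skew $\sigma_i$-derivation $\{d_{i,n}\}_{n\ge0}$ on $A_{i-1}$, and $\sigma_l\circ d_{i,n}=\lambda_{l,i}^n d_{i,n}\circ\sigma_l$ on $A_{i-1}$ for all $n\ge0$, $i+1\le l\le N$. Such an $A$ is a Noetherian domain. Deleting derivations algorithm: put $X_i^{(N+1)}=X_i$, and let $A^{(j)}$ be the subalgebra of $\mathrm{Frac}(A)$ generated by $X_1^{(j)},\dots,X_N^{(j)}$. For $j=N,N-1,\dots,2$ write $x_i=X_i^{(j+1)}$. There is a $\mathbb{K}$-algebra isomorphism $A^{(j+1)}\to\mathbb{K}[X_1]\cdots[X_j;\sigma_j,\delta_j][X_{j+1};\sigma_{j+1}^{(j+1)}]\cdots[X_N;\sigma_N^{(j+1)}]$,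 $x_i\mapsto X_i$, with $\sigma_i^{(j+1)}(X_l)=\lambda_{i,l}X_l$ for $l<i$; via it $\sigma_j$ and $d_{j,n}$ are regarded as maps on $\mathbb{K}\langle x_1,\dots,x_{j-1}\rangle\cong A_{j-1}$. Define $X_l^{(j)}=x_l$ for $l\ge j$ and $X_l^{(j)}=\sum_{n\ge0}q_j^{n(n+1)/2}(q_j-1)^{-n}d_{j,n}\circ\sigma_j^{-n}(x_l)\,x_j^{-n}$ (a finite sum) for $l<j$. *)

theory Defs
  imports Complex_Main "HOL-Library.Poly_Mapping"
begin

section \<open>Algebras over a field\<close>

locale K_algebra = vector_space scale
  for scale :: "'k::field \<Rightarrow> 'a::ring_1 \<Rightarrow> 'a" +
  assumes scale_mult_left: "scale c (a * b) = scale c a * b"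
    and scale_mult_right: "scale c (a * b) = a * scale c b"

definition subalgebra :: "('k::field \<Rightarrow> 'a::ring_1 \<Rightarrow> 'a) \<Rightarrow> 'a set \<Rightarrow> bool" where
  "subalgebra scale R \<longleftrightarrow> 1 \<in> R \<and> (\<forall>a\<in>R. \<forall>b\<in>R. a + b \<in> R \<and> a * b \<in> R)
     \<and> (\<forall>c. \<forall>a\<in>R. scale c a \<in> R)"

abbreviation alg_gen :: "('k::field \<Rightarrow> 'a::ring_1 \<Rightarrow> 'a) \<Rightarrow> 'a set \<Rightarrow> 'a set" where
  "alg_gen scale S \<equiv> subalgebra scale hull S"

definition K_linear_on ::
    "('k::field \<Rightarrow> 'a::ring_1 \<Rightarrow> 'a) \<Rightarrow> 'a set \<Rightarrow> ('a \<Rightarrow> 'a) \<Rightarrow> bool" where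
  "K_linear_on scale R f \<longleftrightarrow> (\<forall>a\<in>R. \<forall>b\<in>R. f (a + b) = f a + f b)
     \<and> (\<forall>c. \<forall>a\<in>R. f (scale c a) = scale c (f a))"

definition alg_iso ::
    "('k::field \<Rightarrow> 'a::ring_1 \<Rightarrow> 'a) \<Rightarrow> 'a set \<Rightarrow> 'a set \<Rightarrow> ('a \<Rightarrow> 'a) \<Rightarrow> bool" where
  "alg_iso scale R S f \<longleftrightarrow> bij_betw f R S \<and> K_linear_on scale R f
     \<and> f 1 = 1 \<and> (\<forall>a\<in>R. \<forall>b\<in>R. f (a * b) = f a * f b)"

lemma alg_iso_unique:
  assumes "K_algebra scale"
    and f: "alg_iso scale (alg_gen scale G) S f" and g: "alg_iso scale (alg_gen scale G) S g"
    and eq: "\<And>x. x \<in> G \<Longrightarrow> f x = g x"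
    and a: "a \<in> alg_gen scale G"
  shows "f a = g a"
proof -
  let ?R = "alg_gen scale G"
  have R: "subalgebra scale ?R"
    by (rule hull_in) (auto simp: subalgebra_def)
  have "subalgebra scale {a. a \<in> ?R \<and> f a = g a}"
    using f g R unfolding alg_iso_def K_linear_on_def subalgebra_def by auto
  then have "?R \<subseteq> {a. a \<in> ?R \<and> f a = g a}"
    by (intro hull_minimal) (auto simp: eq hull_inc)
  with a show ?thesis by blast
qed

section \<open>Ore extensions and higher skew derivations\<close>

definition skew_derivation ::
    "('k::field \<Rightarrow> 'a::ring_1 \<Rightarrow> 'a) \<Rightarrow> 'a set \<Rightarrow> ('a \<Rightarrow> 'a) \<Rightarrow> ('a \<Rightarrow> 'a) \<Rightarrow> bool" where
  "skew_derivation scale R \<sigma> \<delta> \<longleftrightarrow> \<delta> ` R \<subseteq> R \<and> K_linear_on scale R \<delta>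
     \<and> (\<forall>a\<in>R. \<forall>b\<in>R. \<delta> (a * b) = \<sigma> a * \<delta> b + \<delta> a * b)"

text \<open>\<open>ore_extension scale R S x \<sigma> \<delta>\<close> says that the overring \<open>S\<close> of \<open>R\<close> is \<open>R[x; \<sigma>, \<delta>]\<close>:
  it is a free left \<open>R\<close>-module on the powers of \<open>x\<close>, with \<open>x r = \<sigma>(r) x + \<delta>(r)\<close>.\<close>

definition ore_extension ::
    "('k::field \<Rightarrow> 'a::ring_1 \<Rightarrow> 'a) \<Rightarrow> 'a set \<Rightarrow> 'a set \<Rightarrow> 'a \<Rightarrow> ('a \<Rightarrow> 'a) \<Rightarrow> ('a \<Rightarrow> 'a) \<Rightarrow> bool"
  where
  "ore_extension scale R S x \<sigma> \<delta> \<longleftrightarrow>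
     subalgebra scale R \<and> subalgebra scale S \<and> R \<subseteq> S \<and> x \<in> S
     \<and> alg_iso scale R R \<sigma> \<and> skew_derivation scale R \<sigma> \<delta>
     \<and> (\<forall>r\<in>R. x * r = \<sigma> r * x + \<delta> r)
     \<and> (\<forall>a\<in>S. \<exists>!r :: nat \<Rightarrow> 'a. range r \<subseteq> R \<and> finite {n. r n \<noteq> 0}
            \<and> a = (\<Sum>n | r n \<noteq> 0. r n * x ^ n))"

text \<open>Gaussian binomial coefficients at \<open>q\<close>. The quotient of \<open>q\<close>-factorials is \<open>0/0\<close> when \<open>q\<close> is a
  root of unity, so the value at \<open>q\<close> of the integer polynomial is given by the Pascal recursion;
  the lemma below shows that it is the quotient whenever that makes sense.\<close>

fun qbinom :: "'k::comm_ring_1 \<Rightarrow> nat \<Rightarrow> nat \<Rightarrow> 'k" where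
  "qbinom q n 0 = 1"
| "qbinom q 0 (Suc m) = 0"
| "qbinom q (Suc n) (Suc m) = qbinom q n m + q ^ Suc m * qbinom q n (Suc m)"

definition qnum :: "'k::comm_ring_1 \<Rightarrow> nat \<Rightarrow> 'k" where
  "qnum q n = (\<Sum>i<n. q ^ i)"

definition qfact :: "'k::comm_ring_1 \<Rightarrow> nat \<Rightarrow> 'k" where
  "qfact q n = (\<Prod>i=1..n. qnum q i)"

lemma qnum_add: "qnum q (m + n) = qnum q m + q ^ m * qnum q n"
  by (induction n) (auto simp: qnum_def algebra_simps power_add)

lemma qfact_Suc: "qfact q (Suc n) = qnum q (Suc n) * qfact q n"
  by (simp add: qfact_def prod.nat_ivl_Suc' mult.commute)

lemma qbinom_eq_0: "n < m \<Longrightarrow> qbinom q n m = 0"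
  by (induction q n m rule: qbinom.induct) auto

lemma qbinom_diag: "qbinom q n n = 1"
  by (induction n) (auto simp: qbinom_eq_0)

lemma qbinom_qfact: "qbinom q (n + m) m * (qfact q m * qfact q n) = qfact q (n + m)"
proof (induction "n + m" arbitrary: n m)
  case 0
  then show ?case by (simp add: qfact_def)
next
  case (Suc s)
  show ?case
  proof (cases m)
    case 0
    then show ?thesis by (simp add: qfact_def)
  next
    case m: (Suc k)
    show ?thesis
    proof (cases n)
      case 0
      then show ?thesis using qbinom_diag[of q m] by (simp add: qfact_def)
    next
      case n: (Suc l)
      have s1: "qbinom q s k * (qfact q k * qfact q n) = qfact q s"
        using Suc(1)[of n k] Suc(2) m n by simp
      have s2: "qbinom q s m * (qfact q m * qfact q l) = qfact q s"
        using Suc(1)[of l m] Suc(2) m n by simp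
      have nm: "n + m = Suc s" using Suc(2) by simp
      have "qbinom q (n + m) m * (qfact q m * qfact q n)
          = qnum q m * (qbinom q s k * (qfact q k * qfact q n))
            + q ^ m * qnum q n * (qbinom q s m * (qfact q m * qfact q l))"
        unfolding nm using m n by (simp add: qfact_Suc algebra_simps)
      also have "\<dots> = (qnum q m + q ^ m * qnum q n) * qfact q s"
        unfolding s1 s2 by (simp add: algebra_simps)
      also have "\<dots> = qfact q (n + m)"
        unfolding nm qfact_Suc using qnum_add[of q m n] nm by (simp add: add.commute)
      finally show ?thesis .
    qed
  qed
qed

definition higher_skew_derivation ::
    "('k::field \<Rightarrow> 'a::ring_1 \<Rightarrow> 'a) \<Rightarrow> 'a set \<Rightarrow> ('a \<Rightarrow> 'a) \<Rightarrow> 'k \<Rightarrow> (nat \<Rightarrow> 'a \<Rightarrow> 'a) \<Rightarrow> bool" where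
  "higher_skew_derivation scale R \<sigma> q d \<longleftrightarrow>
     (\<forall>n. d n ` R \<subseteq> R \<and> K_linear_on scale R (d n))
     \<and> (\<forall>r\<in>R. d 0 r = r)
     \<and> (\<forall>n. \<forall>r\<in>R. \<forall>s\<in>R. d n (r * s) = (\<Sum>i\<le>n. (\<sigma> ^^ (n - i)) (d i r) * d (n - i) s))
     \<and> (\<forall>n. \<forall>r\<in>R. d n (\<sigma> r) = scale (q ^ n) (\<sigma> (d n r)))"

definition locally_nilpotent_on :: "'a::ring_1 set \<Rightarrow> (nat \<Rightarrow> 'a \<Rightarrow> 'a) \<Rightarrow> bool" where
  "locally_nilpotent_on R d \<longleftrightarrow> (\<forall>r\<in>R. \<exists>m. \<forall>n\<ge>m. d n r = 0)"

definition iterative_on ::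
    "('k::field \<Rightarrow> 'a::ring_1 \<Rightarrow> 'a) \<Rightarrow> 'a set \<Rightarrow> 'k \<Rightarrow> (nat \<Rightarrow> 'a \<Rightarrow> 'a) \<Rightarrow> bool" where
  "iterative_on scale R q d \<longleftrightarrow>
     (\<forall>n m. \<forall>r\<in>R. d n (d m r) = scale (qbinom q (n + m) m) (d (n + m) r))"

section \<open>Quantum nilpotent algebras\<close>

text \<open>The algebra itself is \<open>A N\<close>, a subalgebra of the ambient algebra; the maps \<open>\<sigma> i\<close>, \<open>\<delta> i\<close> and
  \<open>d i n\<close> matter only on \<open>A (i - 1)\<close>, and the indices \<open>i\<close> only in \<open>{1..N}\<close>.
  Here \<open>A 0\<close> is the field of scalars and \<open>A 1\<close> the ordinary polynomial ring in \<open>X 1\<close>.\<close>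

locale quantum_nilpotent_algebra = K_algebra scale
  for scale :: "'k::field \<Rightarrow> 'a::ring_1 \<Rightarrow> 'a" +
  fixes N :: nat
    and X :: "nat \<Rightarrow> 'a"
    and lam :: "nat \<Rightarrow> nat \<Rightarrow> 'k"
    and \<sigma> \<delta> :: "nat \<Rightarrow> 'a \<Rightarrow> 'a"
    and q :: "nat \<Rightarrow> 'k"
    and d :: "nat \<Rightarrow> nat \<Rightarrow> 'a \<Rightarrow> 'a"
    and A :: "nat \<Rightarrow> 'a set"
  defines "A \<equiv> \<lambda>i. alg_gen scale (X ` {1..i})"
  assumes N_pos: "1 \<le> N"
    and polynomial: "ore_extension scale (A 0) (A 1) (X 1) id (\<lambda>_. 0)"
    and ore: "\<And>i. 2 \<le> i \<Longrightarrow> i \<le> N \<Longrightarrow> ore_extension scale (A (i - 1)) (A i) (X i) (\<sigma> i) (\<delta> i)"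
    and \<sigma>_X: "\<And>i l. 2 \<le> i \<Longrightarrow> i \<le> N \<Longrightarrow> 1 \<le> l \<Longrightarrow> l < i \<Longrightarrow> \<sigma> i (X l) = scale (lam i l) (X l)"
    and lam_nonzero: "\<And>i l. i \<in> {1..N} \<Longrightarrow> l \<in> {1..N} \<Longrightarrow> lam i l \<noteq> 0"
    and lam_antisym: "\<And>i l. i \<in> {1..N} \<Longrightarrow> l \<in> {1..N} \<Longrightarrow> lam i l = inverse (lam l i)"
    and lam_diag: "\<And>i. i \<in> {1..N} \<Longrightarrow> lam i i = 1"
    and q_nonzero: "\<And>i. 2 \<le> i \<Longrightarrow> i \<le> N \<Longrightarrow> q i \<noteq> 0"
    and q_neq_1: "\<And>i. 2 \<le> i \<Longrightarrow> i \<le> N \<Longrightarrow> q i \<noteq> 1"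
    and \<delta>_\<sigma>: "\<And>i r. 2 \<le> i \<Longrightarrow> i \<le> N \<Longrightarrow> r \<in> A (i - 1) \<Longrightarrow>
          \<delta> i (\<sigma> i r) = scale (q i) (\<sigma> i (\<delta> i r))"
    and d_higher: "\<And>i. 2 \<le> i \<Longrightarrow> i \<le> N \<Longrightarrow>
          higher_skew_derivation scale (A (i - 1)) (\<sigma> i) (q i) (d i)"
    and d_extends: "\<And>i r. 2 \<le> i \<Longrightarrow> i \<le> N \<Longrightarrow> r \<in> A (i - 1) \<Longrightarrow> d i 1 r = \<delta> i r"
    and d_nilpotent: "\<And>i. 2 \<le> i \<Longrightarrow> i \<le> N \<Longrightarrow> locally_nilpotent_on (A (i - 1)) (d i)"
    and d_iterative: "\<And>i. 2 \<le> i \<Longrightarrow> i \<le> N \<Longrightarrow> iterative_on scale (A (i - 1)) (q i) (d i)"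
    and \<sigma>_d: "\<And>i l n r. 2 \<le> i \<Longrightarrow> i < l \<Longrightarrow> l \<le> N \<Longrightarrow> r \<in> A (i - 1) \<Longrightarrow>
          \<sigma> l (d i n r) = scale (lam l i ^ n) (d i n (\<sigma> l r))"

section \<open>The deleting derivations algorithm\<close>

text \<open>The ambient division ring is \<open>Frac(A)\<close>. A quantum nilpotent algebra is an Ore domain, so right
  fractions suffice.\<close>

definition is_Frac_of :: "'d::division_ring set \<Rightarrow> bool" where
  "is_Frac_of A \<longleftrightarrow> (\<forall>z. \<exists>a\<in>A. \<exists>b\<in>A. b \<noteq> 0 \<and> z = a * inverse b)"

text \<open>The isomorphism \<open>K\<langle>x\<^sub>1, \<dots>, x\<^sub>m\<rangle> \<rightarrow> K\<langle>X\<^sub>1, \<dots>, X\<^sub>m\<rangle>\<close> with \<open>x\<^sub>i \<mapsto> X\<^sub>i\<close>; on its domain it is unique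
  by \<open>alg_iso_unique\<close>. Maps on the target are transported along it to the source.\<close>

definition gen_iso ::
    "('k::field \<Rightarrow> 'a::ring_1 \<Rightarrow> 'a) \<Rightarrow> nat \<Rightarrow> (nat \<Rightarrow> 'a) \<Rightarrow> (nat \<Rightarrow> 'a) \<Rightarrow> 'a \<Rightarrow> 'a" where
  "gen_iso scale m x X =
     (SOME \<phi>. alg_iso scale (alg_gen scale (x ` {1..m})) (alg_gen scale (X ` {1..m})) \<phi>
            \<and> (\<forall>i\<in>{1..m}. \<phi> (x i) = X i))"

definition transport ::
    "('k::field \<Rightarrow> 'a::ring_1 \<Rightarrow> 'a) \<Rightarrow> nat \<Rightarrow> (nat \<Rightarrow> 'a) \<Rightarrow> (nat \<Rightarrow> 'a) \<Rightarrow> ('a \<Rightarrow> 'a) \<Rightarrow> 'a \<Rightarrow> 'a" where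
  "transport scale m x X f r =
     inv_into (alg_gen scale (x ` {1..m})) (gen_iso scale m x X) (f (gen_iso scale m x X r))"

text \<open>One step \<open>X\<^sup>(\<^sup>j\<^sup>+\<^sup>1\<^sup>) = x \<mapsto> X\<^sup>(\<^sup>j\<^sup>)\<close>; the arguments \<open>\<sigma>\<close>, \<open>q\<close>, \<open>d\<close> are \<open>\<sigma>\<^sub>j\<close>, \<open>q\<^sub>j\<close>, \<open>d\<^sub>j\<close>.\<close>

definition dd_step ::
    "('k::field \<Rightarrow> 'd::division_ring \<Rightarrow> 'd) \<Rightarrow> (nat \<Rightarrow> 'd) \<Rightarrow> ('d \<Rightarrow> 'd) \<Rightarrow> 'k \<Rightarrow> (nat \<Rightarrow> 'd \<Rightarrow> 'd)
       \<Rightarrow> nat \<Rightarrow> (nat \<Rightarrow> 'd) \<Rightarrow> nat \<Rightarrow> 'd" where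
  "dd_step scale X \<sigma> q d j x l =
     (if j \<le> l then x l else
       let B = alg_gen scale (x ` {1..j - 1});
           \<sigma>' = transport scale (j - 1) x X \<sigma>;
           d' = (\<lambda>n. transport scale (j - 1) x X (d n));
           c = (\<lambda>n. d' n ((inv_into B \<sigma>' ^^ n) (x l)))
       in \<Sum>n | c n \<noteq> 0.
            scale (q ^ (n * (n + 1) div 2) * inverse (q - 1) ^ n) (c n) * inverse (x j) ^ n)"

text \<open>\<open>dd_gens scale N X \<sigma> q d j i\<close> is \<open>X\<^sub>i\<^sup>(\<^sup>j\<^sup>)\<close>, for \<open>2 \<le> j \<le> N + 1\<close>.\<close>

function dd_gens ::
    "('k::field \<Rightarrow> 'd::division_ring \<Rightarrow> 'd) \<Rightarrow> nat \<Rightarrow> (nat \<Rightarrow> 'd) \<Rightarrow> (nat \<Rightarrow> 'd \<Rightarrow> 'd) \<Rightarrow> (nat \<Rightarrow> 'k)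
       \<Rightarrow> (nat \<Rightarrow> nat \<Rightarrow> 'd \<Rightarrow> 'd) \<Rightarrow> nat \<Rightarrow> nat \<Rightarrow> 'd" where
  "dd_gens scale N X \<sigma> q d j =
     (if N < j then X
      else dd_step scale X (\<sigma> j) (q j) (d j) j (dd_gens scale N X \<sigma> q d (Suc j)))"
  by pat_completeness auto
termination
  by (relation "Wellfounded.measure (\<lambda>(_, N, _, _, _, _, j). Suc N - j)") auto

declare dd_gens.simps [simp del]

definition dd_algebra ::
    "('k::field \<Rightarrow> 'd::division_ring \<Rightarrow> 'd) \<Rightarrow> nat \<Rightarrow> (nat \<Rightarrow> 'd) \<Rightarrow> (nat \<Rightarrow> 'd \<Rightarrow> 'd) \<Rightarrow> (nat \<Rightarrow> 'k)
       \<Rightarrow> (nat \<Rightarrow> nat \<Rightarrow> 'd \<Rightarrow> 'd) \<Rightarrow> nat \<Rightarrow> 'd set" where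
  "dd_algebra scale N X \<sigma> q d j = alg_gen scale (dd_gens scale N X \<sigma> q d j ` {1..N})"

section \<open>Quantum affine spaces\<close>

text \<open>The free monoid, written additively so that finitely supported functions on it form the free
  algebra under the convolution product of \<^type>\<open>poly_mapping\<close>.\<close>

datatype 'i free_mon = Free_mon (letters: "'i list")

instantiation free_mon :: (type) monoid_add
begin

definition "0 = Free_mon []"

definition "u + v = Free_mon (letters u @ letters v)"

instance
  by standard (auto simp: zero_free_mon_def plus_free_mon_def free_mon.expand)

end

type_synonym ('i, 'k) free_alg = "'i free_mon \<Rightarrow>\<^sub>0 'k"

definition free_algebra :: "'i set \<Rightarrow> ('i, 'k::field) free_alg set" where
  "free_algebra I = {f. \<forall>w \<in> Poly_Mapping.keys f. set (letters w) \<subseteq> I}"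

definition free_var :: "'i \<Rightarrow> ('i, 'k::field) free_alg" where
  "free_var i = Poly_Mapping.single (Free_mon [i]) 1"

definition free_const :: "'k::field \<Rightarrow> ('i, 'k) free_alg" where
  "free_const c = Poly_Mapping.single 0 c"

definition free_eval ::
    "('k::field \<Rightarrow> 'a::ring_1 \<Rightarrow> 'a) \<Rightarrow> ('i \<Rightarrow> 'a) \<Rightarrow> ('i, 'k) free_alg \<Rightarrow> 'a" where
  "free_eval scale T f =
     (\<Sum>w \<in> Poly_Mapping.keys f. scale (Poly_Mapping.lookup f w) (prod_list (map T (letters w))))"

definition two_sided_ideal :: "'b::ring_1 set \<Rightarrow> 'b set \<Rightarrow> bool" where
  "two_sided_ideal F J \<longleftrightarrow> J \<subseteq> F \<and> 0 \<in> J \<and> (\<forall>a\<in>J. \<forall>b\<in>J. a - b \<in> J)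
     \<and> (\<forall>r\<in>F. \<forall>a\<in>J. r * a \<in> J \<and> a * r \<in> J)"

definition quantum_relations :: "nat \<Rightarrow> (nat \<Rightarrow> nat \<Rightarrow> 'k::field) \<Rightarrow> (nat, 'k) free_alg set" where
  "quantum_relations N lam =
     {free_var i * free_var j - free_const (lam i j) * free_var j * free_var i | i j.
        i \<in> {1..N} \<and> j \<in> {1..N}}"

text \<open>\<open>B\<close> is the algebra with generators \<open>T 1, \<dots>, T N\<close> and defining relations
  \<open>T i * T j = lam i j * T j * T i\<close>: evaluation maps the free algebra onto \<open>B\<close>, and its kernel is the
  two-sided ideal generated by the relations.\<close>

definition quantum_affine_space ::
    "('k::field \<Rightarrow> 'a::ring_1 \<Rightarrow> 'a) \<Rightarrow> nat \<Rightarrow> (nat \<Rightarrow> nat \<Rightarrow> 'k) \<Rightarrow> (nat \<Rightarrow> 'a) \<Rightarrow> 'a set \<Rightarrow> bool" where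
  "quantum_affine_space scale N lam T B \<longleftrightarrow>
     free_eval scale T ` free_algebra {1..N} = B
     \<and> {f \<in> free_algebra {1..N}. free_eval scale T f = 0}
         = two_sided_ideal (free_algebra {1..N}) hull quantum_relations N lam"

end

theory Submission
  imports Defs
begin

text \<open>One step of the algorithm replaces the generators below \<open>x\<^sub>j\<close> by their images under
  \<open>\<Theta>(r) = \<Sum>\<^sub>n c\<^sub>n d\<^sub>n(\<sigma>\<^sup>-\<^sup>n(r)) x\<^sub>j\<^sup>-\<^sup>n\<close>. The recursion \<open>c\<^sub>n (1 - q\<^sup>-\<^sup>n) = [n] c\<^sub>n\<^sub>-\<^sub>1\<close> gives
  \<open>x\<^sub>j \<Theta>(r) = \<Theta>(\<sigma>(r)) x\<^sub>j\<close>, hence \<open>x\<^sub>j\<^sup>-\<^sup>n \<Theta>(s) = \<Theta>(\<sigma>\<^sup>-\<^sup>n(s)) x\<^sub>j\<^sup>-\<^sup>n\<close>, and with the Leibniz rule and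
  \<open>c\<^sub>i c\<^sub>m = q\<^sup>-\<^sup>i\<^sup>m c\<^sub>i\<^sub>+\<^sub>m\<close> this makes \<open>\<Theta>\<close> multiplicative. So the new generators satisfy one more row
  of the \<open>q\<close>-commutation relations. As \<open>\<Theta>(r) = r\<close> up to negative powers of \<open>x\<^sub>j\<close>, comparing leading
  terms shows that the ordered monomials in the generators from \<open>j\<close> on stay left independent over
  the algebra of the others. At \<open>j = 2\<close> all relations hold and the ordered monomials are linearly
  independent over the field, which forces every relation to follow from the \<open>q\<close>-commutations.\<close>

section \<open>Algebra homomorphisms and independent families\<close>

definition alg_hom_on ::
    "('k::field \<Rightarrow> 'a::ring_1 \<Rightarrow> 'a) \<Rightarrow> 'a set \<Rightarrow> ('a \<Rightarrow> 'a) \<Rightarrow> bool" where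
  "alg_hom_on scale R f \<longleftrightarrow> K_linear_on scale R f \<and> f 1 = 1
     \<and> (\<forall>a\<in>R. \<forall>b\<in>R. f (a * b) = f a * f b)"

text \<open>Coefficients are taken in \<open>R\<close> and enter the ambient ring only through
  \<open>\<psi>\<close>. One notion thus covers powers of an Ore variable (\<open>\<psi>\<close> the
  identity), monomials over a copy of \<open>A (j - 1)\<close>, and monomials over the field
  (\<open>\<psi> k = scale k 1\<close>). Since \<open>r s\<close> itself must vanish, and not just
  \<open>\<psi> (r s)\<close>, a nonempty \<open>L\<close> also forces \<open>\<psi>\<close> to have
  no nonzero zeros on \<open>R\<close>.\<close>

definition left_independent :: "'r::zero set \<Rightarrow> ('r \<Rightarrow> 'a::ring_1) \<Rightarrow> ('i \<Rightarrow> 'a) \<Rightarrow> 'i set \<Rightarrow> bool" where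
  "left_independent R \<psi> m L \<longleftrightarrow> (\<forall>S r. finite S \<longrightarrow> S \<subseteq> L \<longrightarrow> r ` S \<subseteq> R
     \<longrightarrow> (\<Sum>s\<in>S. \<psi> (r s) * m s) = 0 \<longrightarrow> (\<forall>s\<in>S. r s = 0))"

lemma additive_sum:
  fixes R :: "'r::ab_group_add set" and \<psi> :: "'r \<Rightarrow> 'a::ab_group_add"
  assumes "0 \<in> R" and "\<And>a b. a \<in> R \<Longrightarrow> b \<in> R \<Longrightarrow> a + b \<in> R"
    and add: "\<And>a b. a \<in> R \<Longrightarrow> b \<in> R \<Longrightarrow> \<psi> (a + b) = \<psi> a + \<psi> b"
    and "p ` I \<subseteq> R"
  shows "sum p I \<in> R \<and> \<psi> (sum p I) = (\<Sum>i\<in>I. \<psi> (p i))"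
proof -
  have "\<psi> 0 = 0" using add[of 0 0] assms(1) by simp
  then show ?thesis
    using assms by (induction I rule: infinite_finite_induct) auto
qed

text \<open>The relations met later are indexed by words or by pairs, not by monomials, so
  \<open>t\<close> need not be injective. Additivity of \<open>\<psi>\<close> allows terms with
  equal monomials to be collected before independence is applied.\<close>

lemma left_independent_fibre_sum:
  fixes R :: "'r::ab_group_add set" and \<psi> :: "'r \<Rightarrow> 'a::ring_1"
  assumes ind: "left_independent R \<psi> m L"
    and R: "0 \<in> R" "\<And>a b. a \<in> R \<Longrightarrow> b \<in> R \<Longrightarrow> a + b \<in> R"
    and add: "\<And>a b. a \<in> R \<Longrightarrow> b \<in> R \<Longrightarrow> \<psi> (a + b) = \<psi> a + \<psi> b"
    and I: "finite I" "p ` I \<subseteq> R" "t ` I \<subseteq> L"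
    and eq: "(\<Sum>i\<in>I. \<psi> (p i) * m (t i)) = 0"
  shows "(\<Sum>i | i \<in> I \<and> t i = s. p i) = 0"
proof (cases "s \<in> t ` I")
  case True
  define r where "r s = (\<Sum>i | i \<in> I \<and> t i = s. p i)" for s
  have r: "r s \<in> R \<and> \<psi> (r s) = (\<Sum>i | i \<in> I \<and> t i = s. \<psi> (p i))" for s
    unfolding r_def by (rule additive_sum[where R = R and \<psi> = \<psi>]) (use R add I in auto)
  have "(\<Sum>s\<in>t ` I. \<psi> (r s) * m s) = (\<Sum>s\<in>t ` I. \<Sum>i | i \<in> I \<and> t i = s. \<psi> (p i) * m (t i))"
    using r by (auto simp: sum_distrib_right intro!: sum.cong)
  also have "\<dots> = 0" using eq sum.image_gen[OF I(1), of "\<lambda>i. \<psi> (p i) * m (t i)" t] by simp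
  finally have "\<forall>s\<in>t ` I. r s = 0"
    using ind[unfolded left_independent_def, rule_format, of "t ` I" r] I r by (simp add: image_subset_iff)
  with True show ?thesis unfolding r_def by blast
next
  case False
  then have "{i. i \<in> I \<and> t i = s} = {}" by auto
  then show ?thesis by (metis (no_types) sum.empty)
qed

lemma subalgebra_alg_gen: "subalgebra scale (alg_gen scale G)"
  by (rule hull_in) (auto simp: subalgebra_def)

lemma subalgebraD:
  assumes "subalgebra scale R"
  shows "1 \<in> R" "\<And>a b. a \<in> R \<Longrightarrow> b \<in> R \<Longrightarrow> a + b \<in> R"
    "\<And>a b. a \<in> R \<Longrightarrow> b \<in> R \<Longrightarrow> a * b \<in> R" "\<And>c a. a \<in> R \<Longrightarrow> scale c a \<in> R"
  using assms by (auto simp: subalgebra_def)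

text \<open>The elements satisfying \<open>P\<close> form a subalgebra containing \<open>G\<close>.
  Membership in the hull is kept in the cases because the maps considered here obey their laws only
  on their domains.\<close>

lemma alg_gen_induct [consumes 1, case_names gen one add mult scale]:
  assumes "a \<in> alg_gen scale G"
    and "\<And>x. x \<in> G \<Longrightarrow> P x" and "P 1"
    and "\<And>a b. a \<in> alg_gen scale G \<Longrightarrow> b \<in> alg_gen scale G \<Longrightarrow> P a \<Longrightarrow> P b \<Longrightarrow> P (a + b)"
    and "\<And>a b. a \<in> alg_gen scale G \<Longrightarrow> b \<in> alg_gen scale G \<Longrightarrow> P a \<Longrightarrow> P b \<Longrightarrow> P (a * b)"
    and "\<And>c a. a \<in> alg_gen scale G \<Longrightarrow> P a \<Longrightarrow> P (scale c a)"
  shows "P a"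
proof -
  have "subalgebra scale {a \<in> alg_gen scale G. P a}"
    using subalgebra_alg_gen[of scale G] assms unfolding subalgebra_def by auto
  then have "alg_gen scale G \<subseteq> {a \<in> alg_gen scale G. P a}"
    by (intro hull_minimal) (auto simp: assms hull_inc)
  with assms(1) show ?thesis by blast
qed

section \<open>Subalgebras and their homomorphisms\<close>

context K_algebra
begin

lemma scale_mult_scale: "scale a x * scale b y = scale (a * b) (x * y)"
  by (metis scale_mult_left scale_mult_right scale_scale)

lemma subalgebra_zero: "subalgebra scale R \<Longrightarrow> 0 \<in> R"
  by (metis scale_zero_left subalgebraD(1,4))

lemma subalgebra_sum: "subalgebra scale R \<Longrightarrow> p ` I \<subseteq> R \<Longrightarrow> sum p I \<in> R"
  by (induction I rule: infinite_finite_induct) (auto simp: subalgebra_zero subalgebraD)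

lemma subalgebra_power: "subalgebra scale R \<Longrightarrow> a \<in> R \<Longrightarrow> a ^ n \<in> R"
  by (induction n) (auto simp: subalgebraD)

lemma K_linear_on_zero:
  assumes "subalgebra scale R" and "K_linear_on scale R f"
  shows "f 0 = 0"
  using assms subalgebra_zero[OF assms(1)] unfolding K_linear_on_def
  by (metis scale_zero_left)

lemma K_linear_on_sum:
  assumes "subalgebra scale R" and "K_linear_on scale R f" and "p ` I \<subseteq> R"
  shows "f (sum p I) = (\<Sum>i\<in>I. f (p i))"
proof -
  have "sum p I \<in> R \<and> f (sum p I) = (\<Sum>i\<in>I. f (p i))"
    using assms by (intro additive_sum subalgebra_zero) (auto simp: K_linear_on_def subalgebraD)
  then show ?thesis ..
qed

lemma alg_hom_on_power:
  assumes "subalgebra scale R" and "alg_hom_on scale R f" and "a \<in> R"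
  shows "f (a ^ n) = f a ^ n"
  using assms subalgebra_power[OF assms(1,3)]
  by (induction n) (auto simp: alg_hom_on_def)

lemma alg_iso_inv_into:
  assumes R: "subalgebra scale R" and iso: "alg_iso scale R S f"
  shows "alg_iso scale S R (inv_into R f)"
proof -
  let ?g = "inv_into R f"
  have bij: "bij_betw f R S" using iso by (simp add: alg_iso_def)
  have g: "?g b \<in> R" "f (?g b) = b" if "b \<in> S" for b
    using bij that by (auto simp: bij_betw_def f_inv_into_f intro!: inv_into_into)
  have eqI: "?g b = a" if "a \<in> R" "f a = b" for a b
    using that bij by (auto simp: bij_betw_def)
  have hom: "\<And>a b. a \<in> R \<Longrightarrow> b \<in> R \<Longrightarrow> f (a + b) = f a + f b"
    "\<And>a b. a \<in> R \<Longrightarrow> b \<in> R \<Longrightarrow> f (a * b) = f a * f b"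
    "\<And>c a. a \<in> R \<Longrightarrow> f (scale c a) = scale c (f a)" "f 1 = 1"
    using iso by (auto simp: alg_iso_def K_linear_on_def)
  have "?g (a + b) = ?g a + ?g b" "?g (a * b) = ?g a * ?g b" if "a \<in> S" "b \<in> S" for a b
    using that by (auto intro!: eqI simp: hom g subalgebraD[OF R])
  moreover have "?g (scale c a) = scale c (?g a)" if "a \<in> S" for c a
    using that by (auto intro!: eqI simp: hom g subalgebraD[OF R])
  moreover have "?g 1 = 1"
    by (intro eqI) (auto simp: hom subalgebraD[OF R])
  moreover have "bij_betw ?g S R" using bij by (rule bij_betw_inv_into)
  ultimately show ?thesis by (simp add: alg_iso_def K_linear_on_def)
qed

lemma subalgebra_image:
  assumes R: "subalgebra scale R" and f: "alg_hom_on scale R f"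
  shows "subalgebra scale (f ` R)"
proof -
  have "f a + f b = f (a + b)" "f a * f b = f (a * b)" "scale k (f a) = f (scale k a)"
    if "a \<in> R" "b \<in> R" for a b k
    using f that by (auto simp: alg_hom_on_def K_linear_on_def)
  moreover have "1 = f 1" using f by (simp add: alg_hom_on_def)
  ultimately show ?thesis
    using subalgebraD[OF R] unfolding subalgebra_def[of scale "f ` R"] by auto
qed

lemma alg_hom_on_image:
  assumes f: "alg_hom_on scale (alg_gen scale G) f"
  shows "f ` alg_gen scale G = alg_gen scale (f ` G)"
proof
  have "f a \<in> alg_gen scale (f ` G)" if "a \<in> alg_gen scale G" for a
    using that
    by (induction rule: alg_gen_induct)
      (use f subalgebraD[OF subalgebra_alg_gen] in
        \<open>auto simp: hull_inc alg_hom_on_def K_linear_on_def\<close>)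
  then show "f ` alg_gen scale G \<subseteq> alg_gen scale (f ` G)" by blast
  show "alg_gen scale (f ` G) \<subseteq> f ` alg_gen scale G"
    by (intro hull_minimal image_mono subalgebra_image subalgebra_alg_gen f) (auto intro: hull_inc)
qed

text \<open>A vanishing combination is an expansion of \<open>0\<close>, which by uniqueness
  coincides with the zero sequence.\<close>

lemma ore_extension_left_independent:
  assumes "ore_extension scale R S x \<sigma> \<delta>"
  shows "left_independent R (\<lambda>r. r) (\<lambda>n. x ^ n) UNIV"
  unfolding left_independent_def
proof (intro allI impI)
  fix I :: "nat set" and r
  assume I: "finite I" "r ` I \<subseteq> R" and eq: "(\<Sum>n\<in>I. r n * x ^ n) = 0"
  have R: "subalgebra scale R" "subalgebra scale S" using assms by (auto simp: ore_extension_def)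
  \<comment> \<open>Uniqueness concerns sequences on all of \<open>nat\<close>, so \<open>r\<close>
    is extended by zero outside \<open>I\<close>.\<close>
  define r' where "r' n = (if n \<in> I then r n else 0)" for n
  have "{n. r' n \<noteq> 0} \<subseteq> I" by (auto simp: r'_def)
  then have fin: "finite {n. r' n \<noteq> 0}" using I(1) finite_subset by blast
  have "(\<Sum>n | r' n \<noteq> 0. r' n * x ^ n) = (\<Sum>n\<in>I. r n * x ^ n)"
    using I(1) by (intro sum.mono_neutral_cong_left) (auto simp: r'_def)
  then have r': "range r' \<subseteq> R \<and> finite {n. r' n \<noteq> 0} \<and> 0 = (\<Sum>n | r' n \<noteq> 0. r' n * x ^ n)"
    using fin eq I subalgebra_zero[OF R(1)] by (auto simp: r'_def)
  have "range (\<lambda>_::nat. 0) \<subseteq> R \<and> finite {n::nat. (0::'a) \<noteq> 0}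
      \<and> 0 = (\<Sum>n | (0::'a) \<noteq> 0. 0 * x ^ n)"
    using subalgebra_zero[OF R(1)] by auto
  moreover have "\<exists>!r :: nat \<Rightarrow> 'a. range r \<subseteq> R \<and> finite {n. r n \<noteq> 0}
            \<and> 0 = (\<Sum>n | r n \<noteq> 0. r n * x ^ n)"
    using assms subalgebra_zero[OF R(2)] unfolding ore_extension_def by blast
  ultimately have "r' = (\<lambda>_. 0)" using r' by blast
  then show "\<forall>n\<in>I. r n = 0" unfolding r'_def by metis
qed

end

section \<open>The deleting derivations homomorphism\<close>

lemma qnum_eq: "(q - 1) * qnum q n = q ^ n - 1" for q :: "'k::comm_ring_1"
  by (induction n) (auto simp: qnum_def algebra_simps)

text \<open>By iterativity this Gaussian binomial is the factor relating \<open>d 1 (d n r)\<close>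
  to \<open>d (Suc n) r\<close>.\<close>

lemma qbinom_Suc: "qbinom q (Suc n) n = qnum q (Suc n)"
proof (induction n)
  case (Suc n)
  have "qbinom q (Suc (Suc n)) (Suc n) = qbinom q (Suc n) n + q ^ Suc n * qbinom q (Suc n) (Suc n)"
    by (rule qbinom.simps(3))
  with Suc show ?case by (simp only: qbinom_diag) (simp add: qnum_def)
qed (simp add: qnum_def)

text \<open>The maps \<open>\<sigma>\<close> and \<open>d\<close> stay on a fixed \<open>R\<close>,
  and \<open>\<psi>\<close> carries \<open>R\<close> into the division ring where \<open>x\<close>
  is invertible. A step of the algorithm can thus be studied with the original maps; only the Ore
  relation is read through \<open>\<psi>\<close>.\<close>

locale ore_localization = K_algebra scale
  for scale :: "'k::field \<Rightarrow> 'd::division_ring \<Rightarrow> 'd" +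
  fixes R :: "'d set" and \<sigma> :: "'d \<Rightarrow> 'd" and q :: 'k and d :: "nat \<Rightarrow> 'd \<Rightarrow> 'd"
    and \<psi> :: "'d \<Rightarrow> 'd" and x :: 'd
  assumes R: "subalgebra scale R"
    and iso: "alg_iso scale R R \<sigma>"
    and higher: "higher_skew_derivation scale R \<sigma> q d"
    and nilpotent: "locally_nilpotent_on R d"
    and iterative: "iterative_on scale R q d"
    and q0: "q \<noteq> 0" and q1: "q \<noteq> 1"
    and \<psi>: "alg_hom_on scale R \<psi>"
    and x0: "x \<noteq> 0"
    and x_\<psi>: "\<And>r. r \<in> R \<Longrightarrow> x * \<psi> r = \<psi> (\<sigma> r) * x + \<psi> (d 1 r)"
begin

abbreviation \<tau> where "\<tau> \<equiv> inv_into R \<sigma>"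

definition coef :: "nat \<Rightarrow> 'k" where
  "coef n = q ^ (n * (n + 1) div 2) * inverse (q - 1) ^ n"

definition \<Theta> :: "'d \<Rightarrow> 'd" where
  "\<Theta> r = (\<Sum>n | \<psi> (d n ((\<tau> ^^ n) r)) \<noteq> 0. scale (coef n) (\<psi> (d n ((\<tau> ^^ n) r))) * inverse x ^ n)"

section \<open>Identities for the coefficients\<close>

lemma coef_Suc: "coef (Suc n) = coef n * q ^ Suc n * inverse (q - 1)"
proof -
  have "Suc n * (Suc n + 1) div 2 = n * (n + 1) div 2 + Suc n"
    by simp
  then show ?thesis by (simp only: coef_def power_add power_Suc) (simp add: mult_ac)
qed

lemma coef_0 [simp]: "coef 0 = 1" by (simp add: coef_def)

text \<open>Triangular numbers satisfy T(i+m) = T(i) + T(m) + im. The extra power of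
  \<open>q\<close> will cancel the one that appears when \<open>\<sigma> ^^ m\<close> passes
  \<open>d i\<close>.\<close>

lemma coef_add: "coef (i + m) = coef i * coef m * q ^ (i * m)"
  by (induction m) (simp_all add: coef_Suc power_add mult_ac)

text \<open>Both sides are \<open>coef n\<close> times (q^(n+1) - 1)/(q - 1). In this form the
  identity makes the sums in \<open>x_\<Theta>\<close> telescope.\<close>

lemma coef_qnum: "coef n * qnum q (Suc n) = coef (Suc n) * (1 - inverse q ^ Suc n)"
proof -
  have "qnum q (Suc n) = (q ^ Suc n - 1) * inverse (q - 1)"
    using qnum_eq[of q "Suc n"] q1 by (simp add: field_simps)
  moreover have "q ^ Suc n * (1 - inverse q ^ Suc n) = q ^ Suc n - 1"
    using q0 by (simp add: field_simps)
  ultimately show ?thesis by (simp only: coef_Suc mult_ac)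
qed

section \<open>Commutation of \<open>\<sigma>\<close> and its inverse with the higher
  derivations\<close>

lemma \<sigma>_closed: "r \<in> R \<Longrightarrow> \<sigma> r \<in> R" and \<tau>_closed: "r \<in> R \<Longrightarrow> \<tau> r \<in> R"
  and \<sigma>_\<tau>: "r \<in> R \<Longrightarrow> \<sigma> (\<tau> r) = r" and \<tau>_\<sigma>: "r \<in> R \<Longrightarrow> \<tau> (\<sigma> r) = r"
  using iso unfolding alg_iso_def bij_betw_def
  by (auto simp: f_inv_into_f intro!: inv_into_into)

lemma \<tau>_iso: "alg_iso scale R R \<tau>"
  by (rule alg_iso_inv_into[OF R iso])

lemma \<tau>_pow_iso: "alg_iso scale R R (\<tau> ^^ n)"
proof (induction n)
  case 0
  show ?case using R by (auto simp: alg_iso_def K_linear_on_def bij_betw_def)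
next
  case (Suc n)
  have "(\<tau> ^^ n) r \<in> R" if "r \<in> R" for r
    using Suc that unfolding alg_iso_def bij_betw_def by blast
  with Suc \<tau>_iso show ?case
    unfolding alg_iso_def K_linear_on_def by (auto intro: bij_betw_trans)
qed

lemma \<tau>_pow_closed: "r \<in> R \<Longrightarrow> (\<tau> ^^ n) r \<in> R"
  using \<tau>_pow_iso unfolding alg_iso_def bij_betw_def by blast

lemma d_closed: "r \<in> R \<Longrightarrow> d n r \<in> R"
  using higher unfolding higher_skew_derivation_def by blast

lemma d_linear: "K_linear_on scale R (d n)"
  using higher unfolding higher_skew_derivation_def by blast

lemma d_0: "r \<in> R \<Longrightarrow> d 0 r = r"
  using higher unfolding higher_skew_derivation_def by blast

lemma d_mult: "r \<in> R \<Longrightarrow> s \<in> R \<Longrightarrow> d n (r * s) = (\<Sum>i\<le>n. (\<sigma> ^^ (n - i)) (d i r) * d (n - i) s)"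
  using higher unfolding higher_skew_derivation_def by blast

lemma d_\<sigma>: "r \<in> R \<Longrightarrow> d n (\<sigma> r) = scale (q ^ n) (\<sigma> (d n r))"
  using higher unfolding higher_skew_derivation_def by blast

lemma \<sigma>_linear: "K_linear_on scale R \<sigma>" and \<psi>_linear: "K_linear_on scale R \<psi>"
  using iso \<psi> by (auto simp: alg_iso_def alg_hom_on_def)

lemma \<sigma>_d: "r \<in> R \<Longrightarrow> \<sigma> (d n r) = scale (inverse q ^ n) (d n (\<sigma> r))"
  using q0 by (simp add: d_\<sigma> power_inverse)

lemma \<sigma>_pow_closed: "r \<in> R \<Longrightarrow> (\<sigma> ^^ m) r \<in> R"
  by (induction m) (auto simp: \<sigma>_closed)

lemma \<sigma>_pow_d: "r \<in> R \<Longrightarrow> (\<sigma> ^^ m) (d n r) = scale (inverse q ^ (n * m)) (d n ((\<sigma> ^^ m) r))"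
proof (induction m)
  case (Suc m)
  then show ?case
    using \<sigma>_linear d_closed \<sigma>_pow_closed unfolding K_linear_on_def
    by (simp add: \<sigma>_d power_add mult.commute)
qed simp

lemma \<sigma>_pow_\<tau>_pow: "r \<in> R \<Longrightarrow> (\<sigma> ^^ m) ((\<tau> ^^ (m + n)) r) = (\<tau> ^^ n) r"
proof (induction m)
  case (Suc m)
  have "(\<sigma> ^^ Suc m) ((\<tau> ^^ (Suc m + n)) r) = (\<sigma> ^^ m) (\<sigma> (\<tau> ((\<tau> ^^ (m + n)) r)))"
    by (metis add_Suc comp_apply funpow.simps(2) funpow_Suc_right)
  with Suc show ?case by (simp add: \<sigma>_\<tau> \<tau>_pow_closed)
qed simp

text \<open>\<open>\<sigma>\<close> is injective and commutes with \<open>d n\<close> up to a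
  nonzero scalar. Hence a nilpotency bound for \<open>r\<close> also serves every
  \<open>(\<tau> ^^ m) r\<close>.\<close>

lemma d_\<tau>_eq_0:
  assumes "r \<in> R" and "d n r = 0"
  shows "d n ((\<tau> ^^ m) r) = 0"
  using assms
proof (induction m)
  case (Suc m)
  let ?r = "\<tau> ((\<tau> ^^ m) r)"
  have r: "?r \<in> R" using Suc by (simp add: \<tau>_closed \<tau>_pow_closed)
  have "\<sigma> (d n ?r) = 0" using Suc r by (simp add: \<sigma>_d \<sigma>_\<tau> \<tau>_pow_closed)
  then have "\<sigma> (d n ?r) = \<sigma> 0" using K_linear_on_zero[OF R \<sigma>_linear] by simp
  then have "d n ?r = 0" using \<tau>_\<sigma> d_closed[OF r] subalgebra_zero[OF R] by metis
  then show ?case by simp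
qed simp

section \<open>Linearity, commutation and multiplicativity of \<open>\<Theta>\<close>\<close>

lemma \<psi>_0: "\<psi> 0 = 0"
  by (rule K_linear_on_zero[OF R \<psi>_linear])

text \<open>The index set in the definition of \<open>\<Theta>\<close> depends on \<open>r\<close>.
  Replacing it by any sufficiently long initial segment makes the sums for different elements
  comparable.\<close>

lemma \<Theta>_eq:
  assumes "r \<in> R" and "\<And>n. n \<ge> B \<Longrightarrow> d n r = 0"
  shows "\<Theta> r = (\<Sum>n<B. scale (coef n) (\<psi> (d n ((\<tau> ^^ n) r))) * inverse x ^ n)"
proof -
  have "n < B" if "\<psi> (d n ((\<tau> ^^ n) r)) \<noteq> 0" for n
  proof (rule ccontr)
    assume "\<not> n < B"
    then have "d n ((\<tau> ^^ n) r) = 0" using assms by (intro d_\<tau>_eq_0) auto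
    with that \<psi>_0 show False by simp
  qed
  then show ?thesis
    unfolding \<Theta>_def by (intro sum.mono_neutral_left) auto
qed

lemma bound_exists: "r \<in> R \<Longrightarrow> \<exists>B. \<forall>n\<ge>B. d n r = 0"
  using nilpotent unfolding locally_nilpotent_on_def by blast

lemma \<Theta>_linear: "K_linear_on scale R \<Theta>"
proof -
  have lin: "\<psi> (d n ((\<tau> ^^ n) (a + b))) = \<psi> (d n ((\<tau> ^^ n) a)) + \<psi> (d n ((\<tau> ^^ n) b))"
    if "a \<in> R" "b \<in> R" for a b n
    using that \<psi>_linear d_linear \<tau>_pow_iso d_closed \<tau>_pow_closed
    unfolding K_linear_on_def alg_iso_def by simp
  have lin': "\<psi> (d n ((\<tau> ^^ n) (scale c a))) = scale c (\<psi> (d n ((\<tau> ^^ n) a)))" if "a \<in> R" for a c n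
    using that \<psi>_linear d_linear \<tau>_pow_iso d_closed \<tau>_pow_closed
    unfolding K_linear_on_def alg_iso_def by simp
  show ?thesis
    unfolding K_linear_on_def
  proof (intro conjI ballI allI)
    fix a b assume ab: "a \<in> R" "b \<in> R"
    obtain B1 B2 where B: "\<forall>n\<ge>B1. d n a = 0" "\<forall>n\<ge>B2. d n b = 0"
      using ab bound_exists by metis
    have *: "d n (a + b) = d n a + d n b" for n using d_linear ab by (simp add: K_linear_on_def)
    have eq: "\<Theta> r = (\<Sum>n<B1 + B2. scale (coef n) (\<psi> (d n ((\<tau> ^^ n) r))) * inverse x ^ n)"
      if "r \<in> {a, b, a + b}" for r
      using that ab B subalgebraD(2)[OF R] * by (intro \<Theta>_eq) auto
    show "\<Theta> (a + b) = \<Theta> a + \<Theta> b"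
      by (simp add: eq lin[OF ab] scale_right_distrib distrib_right sum.distrib)
  next
    fix c a assume a: "a \<in> R"
    obtain B where B: "\<forall>n\<ge>B. d n a = 0"
      using a bound_exists by metis
    have *: "d n (scale c a) = scale c (d n a)" for n using d_linear a by (simp add: K_linear_on_def)
    have eq: "\<Theta> r = (\<Sum>n<B. scale (coef n) (\<psi> (d n ((\<tau> ^^ n) r))) * inverse x ^ n)"
      if "r \<in> {a, scale c a}" for r
      using that a B subalgebraD(4)[OF R] * by (intro \<Theta>_eq) auto
    show "\<Theta> (scale c a) = scale c (\<Theta> a)"
      by (simp add: eq lin'[OF a] scale_sum_right scale_mult_left mult.commute)
  qed
qed

text \<open>Moving \<open>x\<close> through the n-th term of \<open>\<Theta> r\<close> leaves a
  multiple of the n-th term of \<open>\<Theta> (\<sigma> r) * x\<close>, too small by the factor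
  q^(-n), and a derivation part of index n+1. The derivation part of one index supplies exactly what
  is missing at the next.\<close>

lemma x_\<Theta>:
  assumes r: "r \<in> R"
  shows "x * \<Theta> r = \<Theta> (\<sigma> r) * x"
proof -
  obtain B where B: "\<And>n. n \<ge> B \<Longrightarrow> d n r = 0" using bound_exists[OF r] by blast
  let ?D = "\<lambda>n. d n ((\<tau> ^^ n) (\<sigma> r))"
  have \<sigma>r: "\<sigma> r \<in> R" using r \<sigma>_closed by simp
  have \<sigma>B: "d n (\<sigma> r) = 0" if "n \<ge> B" for n
    using B[OF that] r by (simp add: d_\<sigma> K_linear_on_zero[OF R \<sigma>_linear])
  have D: "?D n \<in> R" for n by (simp add: d_closed \<tau>_pow_closed \<sigma>r)
  have \<tau>Suc: "(\<tau> ^^ Suc n) (\<sigma> r) = (\<tau> ^^ n) r" for n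
    by (simp add: funpow_Suc_right \<tau>_\<sigma> r del: funpow.simps)
  have \<sigma>\<tau>: "\<sigma> ((\<tau> ^^ n) r) = (\<tau> ^^ n) (\<sigma> r)" for n
    using \<tau>Suc[of n] \<sigma>_\<tau>[of "(\<tau> ^^ n) (\<sigma> r)"] \<sigma>r by (simp add: \<tau>_pow_closed)
  \<comment> \<open>\<open>g n\<close> is the part missing from the n-th term. It vanishes at
    \<open>0\<close> because 1 - q^0 = 0, and at \<open>B\<close> by nilpotency, so shifting the
    index loses nothing at either end.\<close>
  define g where "g n = scale (coef n * (1 - inverse q ^ n)) (\<psi> (?D n)) * inverse x ^ n * x" for n
  have g0: "g 0 = 0" by (simp add: g_def)
  have gB: "g B = 0" using d_\<tau>_eq_0[OF \<sigma>r \<sigma>B[of B]] by (simp add: g_def \<psi>_0)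
  have step: "x * (scale (coef n) (\<psi> (d n ((\<tau> ^^ n) r))) * inverse x ^ n)
      = scale (coef n * inverse q ^ n) (\<psi> (?D n)) * inverse x ^ n * x + g (Suc n)" for n
  proof -
    have inv: "x * inverse x ^ n = inverse x ^ n * x"
      using x0 by (intro power_commuting_commutes[symmetric]) simp
    have "d 1 (d n ((\<tau> ^^ n) r)) = scale (qnum q (Suc n)) (?D (Suc n))"
      using iterative r unfolding iterative_on_def
      by (metis \<tau>Suc \<tau>_pow_closed plus_1_eq_Suc qbinom_Suc)
    moreover have "\<sigma> (d n ((\<tau> ^^ n) r)) = scale (inverse q ^ n) (?D n)"
      using r by (simp add: \<sigma>_d \<tau>_pow_closed \<sigma>\<tau>)
    ultimately have "x * \<psi> (d n ((\<tau> ^^ n) r))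
        = scale (inverse q ^ n) (\<psi> (?D n)) * x + scale (qnum q (Suc n)) (\<psi> (?D (Suc n)))"
      using x_\<psi>[of "d n ((\<tau> ^^ n) r)"] r \<psi>_linear D
      by (simp add: d_closed \<tau>_pow_closed K_linear_on_def del: funpow.simps)
    then have "x * (scale (coef n) (\<psi> (d n ((\<tau> ^^ n) r))) * inverse x ^ n)
        = scale (coef n) (scale (inverse q ^ n) (\<psi> (?D n)) * x
            + scale (qnum q (Suc n)) (\<psi> (?D (Suc n)))) * inverse x ^ n"
      by (metis mult.assoc scale_mult_right)
    also have "\<dots> = scale (coef n * inverse q ^ n) (\<psi> (?D n)) * (x * inverse x ^ n)
        + scale (coef n * qnum q (Suc n)) (\<psi> (?D (Suc n))) * inverse x ^ n"
      by (simp add: scale_right_distrib distrib_right scale_mult_left mult.assoc del: funpow.simps)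
    also have "scale (coef n * qnum q (Suc n)) (\<psi> (?D (Suc n))) * inverse x ^ n = g (Suc n)"
      unfolding g_def coef_qnum using x0
      by (simp add: power_Suc2 mult.assoc del: funpow.simps power_Suc)
    finally show ?thesis by (simp add: inv mult.assoc del: funpow.simps)
  qed
  have "(\<Sum>n<B. g (Suc n)) = (\<Sum>n<B. g n)"
    using sum.lessThan_Suc_shift[of g B] g0 gB by simp
  then have "x * \<Theta> r = (\<Sum>n<B. scale (coef n * inverse q ^ n) (\<psi> (?D n)) * inverse x ^ n * x + g n)"
    by (simp only: \<Theta>_eq[OF r B] sum_distrib_left step sum.distrib)
  also have "\<dots> = (\<Sum>n<B. scale (coef n) (\<psi> (?D n)) * inverse x ^ n * x)"
    unfolding g_def
    by (intro sum.cong refl) (simp flip: distrib_right scale_left_distrib, simp add: algebra_simps)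
  finally show ?thesis by (simp only: \<Theta>_eq[OF \<sigma>r \<sigma>B] sum_distrib_right)
qed

text \<open>One step is \<open>x_\<Theta>\<close> at a preimage under \<open>\<sigma>\<close>,
  multiplied by \<open>inverse x\<close> on both sides.\<close>

lemma inverse_x_\<Theta>: "r \<in> R \<Longrightarrow> inverse x ^ n * \<Theta> r = \<Theta> ((\<tau> ^^ n) r) * inverse x ^ n"
proof (induction n)
  case (Suc n)
  let ?r = "(\<tau> ^^ n) r"
  have "x * \<Theta> (\<tau> ?r) = \<Theta> ?r * x" using Suc x_\<Theta>[of "\<tau> ?r"] by (simp add: \<sigma>_\<tau> \<tau>_closed \<tau>_pow_closed)
  then have *: "\<Theta> (\<tau> ?r) * inverse x = inverse x * \<Theta> ?r"
  proof -
    have "\<Theta> (\<tau> ?r) * inverse x = inverse x * (x * \<Theta> (\<tau> ?r)) * inverse x"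
      using x0 by (simp add: mult.assoc[symmetric])
    also have "\<dots> = inverse x * \<Theta> ?r"
      unfolding \<open>x * \<Theta> (\<tau> ?r) = _\<close> using x0 by (simp add: mult.assoc)
    finally show ?thesis .
  qed
  have "inverse x ^ Suc n * \<Theta> r = inverse x * (\<Theta> ?r * inverse x ^ n)"
    using Suc by (simp add: mult.assoc)
  also have "\<dots> = \<Theta> (\<tau> ?r) * inverse x ^ Suc n" by (simp only: power_Suc *[symmetric] mult.assoc[symmetric])
  finally show ?case by simp
qed simp

text \<open>Both sides are the same double sum: the Leibniz rule arranges it by total degree for
  \<open>\<Theta> (r * s)\<close>, and \<open>inverse_x_\<Theta>\<close> factors it as
  \<open>\<Theta> r * \<Theta> s\<close>.\<close>

lemma \<Theta>_mult:
  assumes r: "r \<in> R" and s: "s \<in> R"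
  shows "\<Theta> (r * s) = \<Theta> r * \<Theta> s"
proof -
  obtain Br where Br: "\<And>n. n \<ge> Br \<Longrightarrow> d n r = 0" using bound_exists[OF r] by blast
  obtain Bs where Bs: "\<And>n. n \<ge> Bs \<Longrightarrow> d n s = 0" using bound_exists[OF s] by blast
  have rs: "r * s \<in> R" using r s subalgebraD[OF R] by blast
  obtain B where B: "\<And>n. n \<ge> B \<Longrightarrow> d n (r * s) = 0" using bound_exists[OF rs] by blast
  \<comment> \<open>Large enough that \<open>d n (r * s)\<close> vanishes from \<open>P\<close> on
    and that the triangle \<open>i + m < P\<close> contains the rectangle \<open>i < Br\<close>,
    \<open>m < Bs\<close>.\<close>
  define P where "P = B + Br + Bs"
  \<comment> \<open>The exponent of \<open>\<tau>\<close> on \<open>s\<close> is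
    \<open>m + i\<close>: the surplus \<open>i\<close> is what \<open>inverse x ^ i\<close>
    contributes when it is moved past \<open>\<Theta> s\<close>.\<close>
  define F where "F i m = scale (coef i * coef m) (\<psi> (d i ((\<tau> ^^ i) r)) * \<psi> (d m ((\<tau> ^^ (m + i)) s)))
      * inverse x ^ (m + i)" for i m
  have F0: "F i m = 0" if "i \<ge> Br \<or> m \<ge> Bs" for i m
    using that
  proof
    assume "i \<ge> Br"
    then show ?thesis by (simp add: F_def d_\<tau>_eq_0[OF r Br] \<psi>_0)
  next
    assume "m \<ge> Bs"
    then show ?thesis by (simp add: F_def d_\<tau>_eq_0[OF s Bs] \<psi>_0)
  qed
  have summand: "scale (coef p) (\<psi> (d p ((\<tau> ^^ p) (r * s)))) * inverse x ^ p = (\<Sum>i\<le>p. F i (p - i))" for p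
  proof -
    have R': "(\<sigma> ^^ (p - i)) (d i ((\<tau> ^^ p) r)) * d (p - i) ((\<tau> ^^ p) s) \<in> R" for i
      using r s by (intro subalgebraD(3)[OF R] \<sigma>_pow_closed d_closed \<tau>_pow_closed)
    have "d p ((\<tau> ^^ p) (r * s)) = d p ((\<tau> ^^ p) r * (\<tau> ^^ p) s)"
      using \<tau>_pow_iso r s unfolding alg_iso_def by simp
    also have "\<dots> = (\<Sum>i\<le>p. (\<sigma> ^^ (p - i)) (d i ((\<tau> ^^ p) r)) * d (p - i) ((\<tau> ^^ p) s))"
      using r s by (simp add: d_mult \<tau>_pow_closed)
    finally have "\<psi> (d p ((\<tau> ^^ p) (r * s)))
        = (\<Sum>i\<le>p. \<psi> ((\<sigma> ^^ (p - i)) (d i ((\<tau> ^^ p) r)) * d (p - i) ((\<tau> ^^ p) s)))"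
      using R' by (simp add: K_linear_on_sum[OF R \<psi>_linear] image_subset_iff)
    moreover have "scale (coef p) (\<psi> ((\<sigma> ^^ (p - i)) (d i ((\<tau> ^^ p) r)) * d (p - i) ((\<tau> ^^ p) s)))
        * inverse x ^ p = F i (p - i)" if "i \<le> p" for i
    proof -
      obtain m where p: "p = m + i" using \<open>i \<le> p\<close> by (metis add.commute le_Suc_ex)
      have "(\<sigma> ^^ m) (d i ((\<tau> ^^ p) r)) = scale (inverse q ^ (i * m)) (d i ((\<tau> ^^ i) r))"
        using r by (simp add: \<sigma>_pow_d \<tau>_pow_closed \<sigma>_pow_\<tau>_pow p)
      then have "\<psi> ((\<sigma> ^^ m) (d i ((\<tau> ^^ p) r)) * d m ((\<tau> ^^ p) s))
          = scale (inverse q ^ (i * m)) (\<psi> (d i ((\<tau> ^^ i) r)) * \<psi> (d m ((\<tau> ^^ p) s)))"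
        using r s \<psi> d_closed \<tau>_pow_closed subalgebraD(3,4)[OF R]
        by (simp add: alg_hom_on_def K_linear_on_def flip: scale_mult_left)
      \<comment> \<open>The power of \<open>q\<close> from moving \<open>\<sigma> ^^ m\<close> past
        \<open>d i\<close> cancels the mixed term of \<open>coef_add\<close>.\<close>
      moreover have "coef p * inverse q ^ (i * m) = coef i * coef m"
        using q0 coef_add[of i m] by (simp add: p add.commute[of m] power_inverse)
      ultimately show ?thesis by (simp add: F_def p)
    qed
    ultimately show ?thesis
      by (simp add: scale_sum_right sum_distrib_right)
  qed
  have "\<Theta> (r * s) = (\<Sum>p<P. \<Sum>i\<le>p. F i (p - i))"
    using B by (subst \<Theta>_eq[OF rs, of P]) (auto simp: P_def summand)
  also have "\<dots> = (\<Sum>(i, m)\<in>{(i, m). i + m < P}. F i m)"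
    by (rule sum.triangle_reindex[symmetric])
  also have "\<dots> = (\<Sum>(i, m)\<in>{..<Br} \<times> {..<Bs}. F i m)"
  proof (rule sum.mono_neutral_right)
    show "finite {(i, m). i + m < P}"
      by (rule finite_subset[of _ "{..<P} \<times> {..<P}"]) auto
  qed (auto simp: P_def intro!: F0)
  also have "\<dots> = (\<Sum>i<Br. \<Sum>m<Bs. F i m)"
    by (rule sum.cartesian_product[symmetric])
  also have "\<dots> = (\<Sum>i<Br. scale (coef i) (\<psi> (d i ((\<tau> ^^ i) r))) * (\<Theta> ((\<tau> ^^ i) s) * inverse x ^ i))"
  proof (rule sum.cong[OF refl])
    fix i
    have "\<Theta> ((\<tau> ^^ i) s)
        = (\<Sum>m<Bs. scale (coef m) (\<psi> (d m ((\<tau> ^^ m) ((\<tau> ^^ i) s)))) * inverse x ^ m)"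
      using s Bs by (intro \<Theta>_eq d_\<tau>_eq_0 \<tau>_pow_closed)
    then show "(\<Sum>m<Bs. F i m)
        = scale (coef i) (\<psi> (d i ((\<tau> ^^ i) r))) * (\<Theta> ((\<tau> ^^ i) s) * inverse x ^ i)"
      by (simp add: F_def sum_distrib_left sum_distrib_right funpow_add power_add
          scale_mult_scale[symmetric] mult.assoc)
  qed
  also have "\<dots> = \<Theta> r * \<Theta> s"
    by (simp add: \<Theta>_eq[OF r Br] sum_distrib_right mult.assoc inverse_x_\<Theta>[OF s])
  finally show ?thesis .
qed

text \<open>In the Leibniz expansion of 1 * 1 the middle terms vanish by induction, which leaves
  d_n(1) = d_n(1) + d_n(1).\<close>

lemma d_one:
  assumes "0 < n"
  shows "d n 1 = 0"
  using assms
proof (induction n rule: less_induct)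
  case (less n)
  have one: "1 \<in> R" using R by (rule subalgebraD)
  have \<sigma>1: "(\<sigma> ^^ m) 1 = 1" for m
    using iso by (induction m) (simp_all add: alg_iso_def)
  have "d n (1 * 1) = (\<Sum>i\<le>n. (\<sigma> ^^ (n - i)) (d i 1) * d (n - i) 1)"
    by (rule d_mult[OF one one])
  also have "\<dots> = (\<Sum>i\<in>{0, n}. (\<sigma> ^^ (n - i)) (d i 1) * d (n - i) 1)"
    using less by (intro sum.mono_neutral_right) auto
  finally have "d n 1 = d n 1 + d n 1"
    using less.prems one by (simp add: d_0 \<sigma>1)
  then show ?case by simp
qed

lemma \<Theta>_hom: "alg_hom_on scale R \<Theta>"
proof -
  have one: "1 \<in> R" using R by (rule subalgebraD)
  have "\<Theta> 1 = (\<Sum>n<1. scale (coef n) (\<psi> (d n ((\<tau> ^^ n) 1))) * inverse x ^ n)"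
    by (intro \<Theta>_eq one) (simp add: d_one)
  then have "\<Theta> 1 = 1" using \<psi> one by (simp add: d_0 alg_hom_on_def)
  then show ?thesis by (simp add: alg_hom_on_def \<Theta>_linear \<Theta>_mult)
qed

end

section \<open>Ordered monomials\<close>

text \<open>The list holds the exponents of consecutive variables starting at index
  \<open>j\<close>. Keeping the start as an argument lets the first variable be split off, with a
  monomial of the same kind remaining.\<close>

primrec ordered_monomial :: "(nat \<Rightarrow> 'a::monoid_mult) \<Rightarrow> nat \<Rightarrow> nat list \<Rightarrow> 'a" where
  "ordered_monomial y j [] = 1"
| "ordered_monomial y j (e # s) = y j ^ e * ordered_monomial y (Suc j) s"

lemma ordered_monomial_cong:
  "(\<And>i. j \<le> i \<Longrightarrow> y i = z i) \<Longrightarrow> ordered_monomial y j s = ordered_monomial z j s"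
  by (induction s arbitrary: j) auto

context K_algebra
begin

lemma power_skew_commute:
  assumes "u * v = scale c (v * u)"
  shows "u ^ n * v = scale (c ^ n) (v * u ^ n)" and "u * v ^ n = scale (c ^ n) (v ^ n * u)"
proof -
  show "u ^ n * v = scale (c ^ n) (v * u ^ n)"
  proof (induction n)
    case (Suc n)
    have "u ^ Suc n * v = u * scale (c ^ n) (v * u ^ n)" by (simp add: Suc mult.assoc)
    also have "\<dots> = scale (c ^ n) (u * v * u ^ n)" by (simp add: mult.assoc flip: scale_mult_right)
    finally show ?case by (simp add: assms mult.assoc mult.commute flip: scale_mult_left)
  qed simp
  show "u * v ^ n = scale (c ^ n) (v ^ n * u)"
  proof (induction n)
    case (Suc n)
    have "u * v ^ Suc n = u * v * v ^ n" by (simp add: mult.assoc)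
    also have "\<dots> = scale c (v * (u * v ^ n))" by (simp add: assms mult.assoc flip: scale_mult_left)
    also have "\<dots> = scale (c ^ Suc n) (v ^ Suc n * u)"
      by (simp add: Suc mult.assoc flip: scale_mult_right)
    finally show ?case .
  qed simp
qed

text \<open>The scalars from the single variables multiply. Only that the result is nonzero matters
  later, so its value is left existential.\<close>

lemma ordered_monomial_skew_commute:
  assumes "\<And>i. j \<le> i \<Longrightarrow> i < j + length s \<Longrightarrow> \<exists>c. c \<noteq> 0 \<and> y i * v = scale c (v * y i)"
  shows "\<exists>c. c \<noteq> 0 \<and> ordered_monomial y j s * v = scale c (v * ordered_monomial y j s)"
  using assms
proof (induction s arbitrary: j)
  case Nil
  then show ?case by (intro exI[of _ 1]) simp
next
  case (Cons e s)
  obtain c where c: "c \<noteq> 0" "y j * v = scale c (v * y j)" using Cons.prems[of j] by auto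
  obtain c' where c': "c' \<noteq> 0"
    "ordered_monomial y (Suc j) s * v = scale c' (v * ordered_monomial y (Suc j) s)"
    using Cons.IH[of "Suc j"] Cons.prems by auto
  have "ordered_monomial y j (e # s) * v = scale c' (y j ^ e * v * ordered_monomial y (Suc j) s)"
    by (simp add: c' mult.assoc flip: scale_mult_right)
  also have "\<dots> = scale (c' * c ^ e) (v * ordered_monomial y j (e # s))"
    by (simp add: power_skew_commute(1)[OF c(2)] mult.assoc flip: scale_mult_left)
  finally show ?case using c c' by (intro exI[of _ "c' * c ^ e"]) simp
qed

end

section \<open>The deleting derivations algorithm\<close>

locale quantum_nilpotent_in_division_ring = quantum_nilpotent_algebra scale N X lam \<sigma> \<delta> q d
  for scale :: "'k::field \<Rightarrow> 'd::division_ring \<Rightarrow> 'd"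
    and N :: nat and X :: "nat \<Rightarrow> 'd" and lam :: "nat \<Rightarrow> nat \<Rightarrow> 'k"
    and \<sigma> \<delta> :: "nat \<Rightarrow> 'd \<Rightarrow> 'd" and q :: "nat \<Rightarrow> 'k" and d :: "nat \<Rightarrow> nat \<Rightarrow> 'd \<Rightarrow> 'd"
begin

text \<open>The state of the algorithm with generators \<open>y = X\<^sup>(\<^sup>j\<^sup>)\<close>; the isomorphism of the first \<open>j - 1\<close>
  variables is read backwards, as \<open>\<psi>\<close> from \<open>A (j - 1)\<close>.\<close>

definition dd_invariant :: "nat \<Rightarrow> (nat \<Rightarrow> 'd) \<Rightarrow> ('d \<Rightarrow> 'd) \<Rightarrow> bool" where
  "dd_invariant j y \<psi> \<longleftrightarrow> alg_hom_on scale (A (j - 1)) \<psi>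
     \<and> (\<forall>l\<in>{1..j - 1}. \<psi> (X l) = y l)
     \<and> (\<forall>i l. j \<le> i \<longrightarrow> i \<le> N \<longrightarrow> 1 \<le> l \<longrightarrow> l < i \<longrightarrow> y i * y l = scale (lam i l) (y l * y i))
     \<and> left_independent (A (j - 1)) \<psi> (ordered_monomial y j) {s. length s = N + 1 - j}"

section \<open>The filtration by the \<open>A i\<close> and the initial state\<close>

lemma subalgebra_A: "subalgebra scale (A i)"
  unfolding A_def by (rule subalgebra_alg_gen)

lemma A_mono: "i \<le> j \<Longrightarrow> A i \<subseteq> A j"
  unfolding A_def by (intro hull_mono image_mono) auto

lemma X_in_A: "1 \<le> l \<Longrightarrow> l \<le> i \<Longrightarrow> X l \<in> A i"
  unfolding A_def by (intro hull_inc) auto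

lemma A_induct [consumes 1, case_names gen one add mult scale]:
  assumes "a \<in> A i"
    and "\<And>l. 1 \<le> l \<Longrightarrow> l \<le> i \<Longrightarrow> P (X l)" and "P 1"
    and "\<And>a b. a \<in> A i \<Longrightarrow> b \<in> A i \<Longrightarrow> P a \<Longrightarrow> P b \<Longrightarrow> P (a + b)"
    and "\<And>a b. a \<in> A i \<Longrightarrow> b \<in> A i \<Longrightarrow> P a \<Longrightarrow> P b \<Longrightarrow> P (a * b)"
    and "\<And>c a. a \<in> A i \<Longrightarrow> P a \<Longrightarrow> P (scale c a)"
  shows "P a"
  using assms(1) unfolding A_def
  by (induction rule: alg_gen_induct) (use assms(2-) in \<open>auto simp: A_def\<close>)

lemma dd_invariant_start: "dd_invariant (Suc N) X (\<lambda>a. a)"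
proof -
  have "left_independent (A N) (\<lambda>a. a) (ordered_monomial X (Suc N)) {s. length s = 0}"
    unfolding left_independent_def
  proof (intro allI impI)
    fix S :: "nat list set" and r assume S: "S \<subseteq> {s. length s = 0}"
      and eq: "(\<Sum>s\<in>S. r s * ordered_monomial X (Suc N) s) = 0"
    have "S = {} \<or> S = {[]}" using S by auto
    then show "\<forall>s\<in>S. r s = 0" using eq by auto
  qed
  then show ?thesis by (simp add: dd_invariant_def alg_hom_on_def K_linear_on_def)
qed

end

section \<open>A single deleting derivations step\<close>

locale deleting_step = quantum_nilpotent_in_division_ring +
  fixes j :: nat and y and \<psi>
  assumes j: "2 \<le> j" "j \<le> N" and inv: "dd_invariant (Suc j) y \<psi>"
begin

declare One_nat_def [simp del]

lemma inv_hom: "alg_hom_on scale (A j) \<psi>"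
  and inv_X: "\<And>l. 1 \<le> l \<Longrightarrow> l \<le> j \<Longrightarrow> \<psi> (X l) = y l"
  and inv_comm: "\<And>i l. j < i \<Longrightarrow> i \<le> N \<Longrightarrow> 1 \<le> l \<Longrightarrow> l < i \<Longrightarrow> y i * y l = scale (lam i l) (y l * y i)"
  and inv_independent:
    "left_independent (A j) \<psi> (ordered_monomial y (Suc j)) {s. length s = N - j}"
  using inv by (auto simp: dd_invariant_def)

lemma inv_linear: "K_linear_on scale (A j) \<psi>" and inv_1: "\<psi> 1 = 1"
  and inv_mult: "\<And>a b. a \<in> A j \<Longrightarrow> b \<in> A j \<Longrightarrow> \<psi> (a * b) = \<psi> a * \<psi> b"
  using inv_hom by (auto simp: alg_hom_on_def)

lemma inv_add: "a \<in> A j \<Longrightarrow> b \<in> A j \<Longrightarrow> \<psi> (a + b) = \<psi> a + \<psi> b"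
  and inv_scale: "a \<in> A j \<Longrightarrow> \<psi> (scale c a) = scale c (\<psi> a)"
  using inv_linear by (auto simp: K_linear_on_def)

text \<open>The independence in the invariant already contains this: it is applied to one monomial,
  the one with all exponents zero.\<close>

lemma inv_eq_0:
  assumes "a \<in> A j" and "\<psi> a = 0"
  shows "a = 0"
proof -
  have "ordered_monomial y (Suc j) s * \<psi> a = 0" for s by (simp add: assms)
  then show ?thesis
    using inv_independent[unfolded left_independent_def, rule_format,
        of "{replicate (N - j) 0}" "\<lambda>_. a"] assms
    by simp
qed

lemma inv_inj: "inj_on \<psi> (A j)"
proof (rule inj_onI)
  fix a b assume ab: "a \<in> A j" "b \<in> A j" "\<psi> a = \<psi> b"
  have mb: "scale (-1) b \<in> A j" using ab subalgebraD[OF subalgebra_A] by blast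
  have "\<psi> (a + scale (-1) b) = \<psi> a + scale (-1) (\<psi> b)"
    by (simp only: inv_add inv_scale ab mb)
  then have "\<psi> (a + scale (-1) b) = 0" using ab by simp
  then have "a + scale (-1) b = 0"
    by (rule inv_eq_0[OF subalgebraD(2)[OF subalgebra_A ab(1) mb]])
  then show "a = b" by simp
qed

lemma A_j_subset: "a \<in> A (j - 1) \<Longrightarrow> a \<in> A j"
  using A_mono[of "j - 1" j] by auto

text \<open>\<open>X j\<close> is nonzero because its powers are independent over
  \<open>A (j - 1)\<close>, and \<open>\<psi>\<close> kills no nonzero element of
  \<open>A j\<close>.\<close>

lemma inv_y_nonzero: "y j \<noteq> 0"
proof
  assume "y j = 0"
  then have "X j = 0" using inv_eq_0[of "X j"] X_in_A[of j j] inv_X[of j] j by simp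
  then have "(\<Sum>n\<in>{1::nat}. 1 * X j ^ n) = 0" by simp
  then have "\<forall>n\<in>{1::nat}. 1 = (0::'b)"
    using ore_extension_left_independent[OF ore[OF j], unfolded left_independent_def,
        rule_format, of "{1}" "\<lambda>_. 1"] subalgebraD(1)[OF subalgebra_A] by auto
  then show False by simp
qed

sublocale loc: ore_localization scale "A (j - 1)" "\<sigma> j" "q j" "d j" \<psi> "y j"
proof unfold_locales
  show "subalgebra scale (A (j - 1))" by (rule subalgebra_A)
  show "alg_iso scale (A (j - 1)) (A (j - 1)) (\<sigma> j)"
    using ore[OF j] by (simp add: ore_extension_def)
  show "higher_skew_derivation scale (A (j - 1)) (\<sigma> j) (q j) (d j)" by (rule d_higher[OF j])
  show "locally_nilpotent_on (A (j - 1)) (d j)" by (rule d_nilpotent[OF j])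
  show "iterative_on scale (A (j - 1)) (q j) (d j)" by (rule d_iterative[OF j])
  show "q j \<noteq> 0" "q j \<noteq> 1" using q_nonzero q_neq_1 j by auto
  show "alg_hom_on scale (A (j - 1)) \<psi>"
    using inv_hom A_j_subset by (auto simp: alg_hom_on_def K_linear_on_def)
  show "y j \<noteq> 0" by (rule inv_y_nonzero)
  fix r assume r: "r \<in> A (j - 1)"
  have cl: "\<sigma> j r \<in> A j" "\<delta> j r \<in> A j" "X j \<in> A j"
    using ore[OF j] r A_j_subset j X_in_A
    unfolding ore_extension_def alg_iso_def bij_betw_def skew_derivation_def by auto
  have "X j * r = \<sigma> j r * X j + \<delta> j r" using ore[OF j] r by (simp add: ore_extension_def)
  then have "\<psi> (X j * r) = \<psi> (\<sigma> j r * X j + \<delta> j r)" by simp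
  then show "y j * \<psi> r = \<psi> (\<sigma> j r) * y j + \<psi> (d j 1 r)"
    using r cl A_j_subset[OF r] j subalgebraD(3)[OF subalgebra_A] d_extends[OF j r]
    by (simp add: inv_add inv_mult inv_X)
qed

abbreviation z where
  "z \<equiv> dd_step scale X (\<sigma> j) (q j) (d j) j y"

section \<open>Identification of the transported maps\<close>

lemma \<psi>_iso: "alg_iso scale (A (j - 1)) (alg_gen scale (y ` {1..j - 1})) \<psi>"
proof -
  have "\<psi> ` A (j - 1) = alg_gen scale (\<psi> ` X ` {1..j - 1})"
    unfolding A_def by (rule alg_hom_on_image) (use loc.\<psi> in \<open>simp add: A_def\<close>)
  also have "\<psi> ` X ` {1..j - 1} = y ` {1..j - 1}"
    unfolding image_image by (intro image_cong refl inv_X) auto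
  finally have "bij_betw \<psi> (A (j - 1)) (alg_gen scale (y ` {1..j - 1}))"
    using inj_on_subset[OF inv_inj A_mono[of "j - 1" j]] by (simp add: bij_betw_def)
  then show ?thesis using loc.\<psi> by (simp add: alg_iso_def alg_hom_on_def)
qed

text \<open>The inverse of \<open>\<psi>\<close> meets the specification in \<open>gen_iso\<close>,
  so the choice there is not vacuous. Agreement on generators then forces the chosen map to be this
  inverse.\<close>

lemma gen_iso_\<psi>:
  "alg_iso scale (alg_gen scale (y ` {1..j - 1})) (A (j - 1)) (gen_iso scale (j - 1) y X)"
  "\<And>a. a \<in> A (j - 1) \<Longrightarrow> gen_iso scale (j - 1) y X (\<psi> a) = a"
proof -
  let ?\<phi> = "inv_into (A (j - 1)) \<psi>" and ?g = "gen_iso scale (j - 1) y X"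
  let ?B = "alg_gen scale (y ` {1..j - 1})"
  have bij: "bij_betw \<psi> (A (j - 1)) ?B" using \<psi>_iso by (simp add: alg_iso_def)
  have \<phi>: "alg_iso scale ?B (A (j - 1)) ?\<phi>"
    by (rule alg_iso_inv_into[OF subalgebra_A \<psi>_iso])
  have \<phi>_\<psi>: "?\<phi> (\<psi> a) = a" if "a \<in> A (j - 1)" for a
    using bij that by (simp add: bij_betw_def)
  have \<phi>_y: "?\<phi> (y i) = X i" if "i \<in> {1..j - 1}" for i
    using \<phi>_\<psi>[of "X i"] that inv_X[of i] X_in_A[of i "j - 1"] by auto
  have g: "alg_iso scale ?B (A (j - 1)) ?g \<and> (\<forall>i\<in>{1..j - 1}. ?g (y i) = X i)"
    unfolding gen_iso_def A_def
    by (rule someI[where x = "inv_into (A (j - 1)) \<psi>"]) (use \<phi> \<phi>_y in \<open>simp add: A_def\<close>)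
  then show "alg_iso scale ?B (A (j - 1)) ?g" by blast
  fix a assume a: "a \<in> A (j - 1)"
  have "?g (\<psi> a) = ?\<phi> (\<psi> a)"
  proof (rule alg_iso_unique[where G = "y ` {1..j - 1}" and S = "A (j - 1)" and f = ?g and g = ?\<phi>])
    show "K_algebra scale" by unfold_locales
    show "alg_iso scale ?B (A (j - 1)) ?g" "alg_iso scale ?B (A (j - 1)) ?\<phi>" using g \<phi> by auto
    show "\<psi> a \<in> ?B" using bij a by (auto simp: bij_betw_def)
    show "?g x = ?\<phi> x" if "x \<in> y ` {1..j - 1}" for x using that g \<phi>_y by auto
  qed
  with \<phi>_\<psi>[OF a] show "?g (\<psi> a) = a" by simp
qed

lemma transport_\<psi>:
  assumes "a \<in> A (j - 1)" and "f a \<in> A (j - 1)"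
  shows "transport scale (j - 1) y X f (\<psi> a) = \<psi> (f a)"
  unfolding transport_def gen_iso_\<psi>(2)[OF assms(1)]
proof (rule inv_into_f_eq)
  show "inj_on (gen_iso scale (j - 1) y X) (alg_gen scale (y ` {1..j - 1}))"
    using gen_iso_\<psi>(1) by (simp add: alg_iso_def bij_betw_def)
  show "\<psi> (f a) \<in> alg_gen scale (y ` {1..j - 1})"
    using \<psi>_iso assms unfolding alg_iso_def bij_betw_def by blast
qed (rule gen_iso_\<psi>(2)[OF assms(2)])

lemma inv_into_transport_\<psi>:
  assumes "a \<in> A (j - 1)"
  shows "inv_into (alg_gen scale (y ` {1..j - 1})) (transport scale (j - 1) y X (\<sigma> j)) (\<psi> a)
    = \<psi> (loc.\<tau> a)"
proof (rule inv_into_f_eq)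
  have B: "alg_gen scale (y ` {1..j - 1}) = \<psi> ` A (j - 1)"
    using \<psi>_iso by (simp add: alg_iso_def bij_betw_def)
  have tr: "transport scale (j - 1) y X (\<sigma> j) (\<psi> b) = \<psi> (\<sigma> j b)" if "b \<in> A (j - 1)" for b
    using that by (intro transport_\<psi> loc.\<sigma>_closed)
  have "inj_on (\<psi> \<circ> \<sigma> j) (A (j - 1))"
    using loc.iso \<psi>_iso by (auto simp: alg_iso_def bij_betw_def intro: comp_inj_on)
  then show "inj_on (transport scale (j - 1) y X (\<sigma> j)) (alg_gen scale (y ` {1..j - 1}))"
    unfolding B by (auto simp: inj_on_def tr)
  show "\<psi> (loc.\<tau> a) \<in> alg_gen scale (y ` {1..j - 1})"
    unfolding B using assms loc.\<tau>_closed by blast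
  show "transport scale (j - 1) y X (\<sigma> j) (\<psi> (loc.\<tau> a)) = \<psi> a"
    using assms by (simp add: tr loc.\<tau>_closed loc.\<sigma>_\<tau>)
qed

text \<open>Transport is conjugation by \<open>\<psi>\<close>, so the formula of the algorithm
  becomes the series \<open>\<Theta>\<close> at the original generator.\<close>

lemma z_eq_\<Theta>:
  assumes l: "1 \<le> l" "l \<le> j - 1"
  shows "z l = loc.\<Theta> (X l)"
proof -
  let ?\<tau> = "inv_into (alg_gen scale (y ` {1..j - 1})) (transport scale (j - 1) y X (\<sigma> j))"
  have Xl: "X l \<in> A (j - 1)" using l by (intro X_in_A)
  have "(?\<tau> ^^ n) (\<psi> (X l)) = \<psi> ((loc.\<tau> ^^ n) (X l))" for n
    by (induction n) (simp_all add: inv_into_transport_\<psi> loc.\<tau>_pow_closed Xl)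
  then have "transport scale (j - 1) y X (d j n) ((?\<tau> ^^ n) (y l))
      = \<psi> (d j n ((loc.\<tau> ^^ n) (X l)))" for n
    using transport_\<psi>[of "(loc.\<tau> ^^ n) (X l)" "d j n"] inv_X[of l] l
    by (simp add: loc.\<tau>_pow_closed loc.d_closed Xl)
  moreover have "\<not> j \<le> l" using l j by linarith
  ultimately show ?thesis
    by (simp add: dd_step_def Let_def loc.\<Theta>_def loc.coef_def)
qed

lemma z_eq_y: "j \<le> l \<Longrightarrow> z l = y l"
  by (simp add: dd_step_def)

section \<open>Commutation relations of the new generators\<close>

lemma y_\<psi>:
  assumes i: "j < i" "i \<le> N" and a: "a \<in> A (j - 1)"
  shows "y i * \<psi> a = \<psi> (\<sigma> i a) * y i"
proof -
  have i2: "2 \<le> i" using i j by simp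
  have iso: "alg_iso scale (A (i - 1)) (A (i - 1)) (\<sigma> i)"
    using ore[OF i2 i(2)] by (simp add: ore_extension_def)
  have sub: "A (j - 1) \<subseteq> A (i - 1)" using i by (intro A_mono) simp
  \<comment> \<open>\<open>\<sigma> i\<close> is only known to preserve \<open>A (i - 1)\<close>.
    That it preserves the smaller \<open>A (j - 1)\<close> is proved in the same induction, since
    \<open>\<psi> (\<sigma> i a)\<close> must make sense at every stage.\<close>
  have "\<sigma> i a \<in> A (j - 1) \<and> y i * \<psi> a = \<psi> (\<sigma> i a) * y i"
    using a
  proof (induction rule: A_induct)
    case (gen l)
    have Xl: "X l \<in> A (j - 1)" using gen by (intro X_in_A)
    have "\<sigma> i (X l) = scale (lam i l) (X l)" using \<sigma>_X[OF i2 i(2), of l] gen i by simp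
    moreover have "y i * y l = scale (lam i l) (y l * y i)" using inv_comm[OF i] gen i by simp
    ultimately show ?case
      using Xl subalgebraD(4)[OF subalgebra_A] A_j_subset gen inv_X[of l]
      by (simp add: inv_scale scale_mult_left)
  next
    case one
    show ?case using iso inv_1 subalgebraD(1)[OF subalgebra_A] by (simp add: alg_iso_def)
  next
    case (add a b)
    note IH = add
    have "\<sigma> i (a + b) = \<sigma> i a + \<sigma> i b"
      using iso IH(1,2) sub unfolding alg_iso_def K_linear_on_def by blast
    then show ?case
      using IH A_j_subset subalgebraD(2)[OF subalgebra_A]
      by (simp add: inv_add distrib_left distrib_right)
  next
    case (mult a b)
    note IH = mult
    have "\<sigma> i (a * b) = \<sigma> i a * \<sigma> i b"
      using iso IH(1,2) sub unfolding alg_iso_def by blast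
    moreover have "y i * (\<psi> a * \<psi> b) = \<psi> (\<sigma> i a) * \<psi> (\<sigma> i b) * y i"
      using IH(3,4) by (metis mult.assoc)
    ultimately show ?case
      using IH A_j_subset subalgebraD(3)[OF subalgebra_A]
      by (simp add: inv_mult)
  next
    case (scale c a)
    note IH = scale
    have "\<sigma> i (scale c a) = scale c (\<sigma> i a)"
      using iso IH(1) sub unfolding alg_iso_def K_linear_on_def by blast
    then show ?case
      using IH A_j_subset subalgebraD(4)[OF subalgebra_A]
      by (simp add: inv_scale flip: scale_mult_left scale_mult_right)
  qed
  then show ?thesis ..
qed

lemma \<tau>_pow_X:
  assumes l: "1 \<le> l" "l \<le> j - 1"
  shows "(loc.\<tau> ^^ n) (X l) = scale (inverse (lam j l) ^ n) (X l)"
proof (induction n)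
  case (Suc n)
  have Xl: "X l \<in> A (j - 1)" using l by (intro X_in_A)
  have lam: "lam j l \<noteq> 0" using l j by (intro lam_nonzero) auto
  have "loc.\<tau> (\<sigma> j (X l)) = X l" by (rule loc.\<tau>_\<sigma>[OF Xl])
  moreover have "\<sigma> j (X l) = scale (lam j l) (X l)" using l j by (intro \<sigma>_X) auto
  moreover have lin: "loc.\<tau> (scale c (X l)) = scale c (loc.\<tau> (X l))" for c
    using loc.\<tau>_iso Xl by (simp add: alg_iso_def K_linear_on_def)
  ultimately have "scale (lam j l) (loc.\<tau> (X l)) = X l" by simp
  then have "loc.\<tau> (X l) = scale (inverse (lam j l)) (X l)"
    using lam by (metis left_inverse scale_one scale_scale)
  then show ?case using Suc by (simp add: lin mult.commute)
qed simp

text \<open>Relations among unchanged generators persist, and the new row \<open>i = j\<close> is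
  \<open>x_\<Theta>\<close>. For \<open>i > j\<close> the generator \<open>y i\<close> passes every
  summand of \<open>\<Theta> (X l)\<close> with the same scalar \<open>lam i l\<close>.\<close>

lemma z_commute:
  assumes i: "j \<le> i" "i \<le> N" and l: "1 \<le> l" "l < i"
  shows "z i * z l = scale (lam i l) (z l * z i)"
proof -
  consider "j \<le> l" | "l \<le> j - 1" "i = j" | "l \<le> j - 1" "j < i" using i l by linarith
  then show ?thesis
  proof cases
    case 1
    then show ?thesis using inv_comm[of i l] i l by (simp add: z_eq_y)
  next
    case 2
    have Xl: "X l \<in> A (j - 1)" using 2 l by (intro X_in_A)
    have "\<sigma> j (X l) = scale (lam j l) (X l)" using l 2 j by (intro \<sigma>_X) auto
    then have "y j * loc.\<Theta> (X l) = scale (lam j l) (loc.\<Theta> (X l)) * y j"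
      using loc.x_\<Theta>[OF Xl] loc.\<Theta>_linear Xl by (simp add: K_linear_on_def)
    then show ?thesis using 2 l by (simp add: z_eq_y z_eq_\<Theta> scale_mult_left)
  next
    case 3
    have Xl: "X l \<in> A (j - 1)" using 3 l by (intro X_in_A)
    have i2: "2 \<le> i" using 3 j by simp
    let ?D = "\<lambda>n. d j n ((loc.\<tau> ^^ n) (X l))"
    have D: "?D n \<in> A (j - 1)" for n by (intro loc.d_closed loc.\<tau>_pow_closed Xl)
    have iso: "alg_iso scale (A (i - 1)) (A (i - 1)) (\<sigma> i)"
      using ore[OF i2 i(2)] by (simp add: ore_extension_def)
    have sub: "a \<in> A (i - 1)" if "a \<in> A (j - 1)" for a
      using that 3(2) A_mono[of "j - 1" "i - 1"] by (meson diff_le_mono less_imp_le subsetD)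
    have lam: "lam i j \<noteq> 0" using i j by (intro lam_nonzero) auto
    \<comment> \<open>Compatibility of \<open>\<sigma> i\<close> with \<open>d j n\<close> produces
      \<open>lam i j ^ n\<close>. The power of \<open>\<tau>\<close> only multiplies
      \<open>X l\<close> by a scalar, which occurs on both sides.\<close>
    have "\<sigma> i (?D n) = scale (lam i j ^ n * lam i l) (?D n)" for n
    proof -
      have Dn: "?D n = scale (inverse (lam j l) ^ n) (d j n (X l))"
        using loc.d_linear Xl l 3 by (simp add: \<tau>_pow_X K_linear_on_def)
      have "\<sigma> i (d j n (X l)) = scale (lam i j ^ n) (d j n (\<sigma> i (X l)))"
        using \<sigma>_d[OF j(1) 3(2) i(2) Xl] .
      also have "\<sigma> i (X l) = scale (lam i l) (X l)" using l i i2 by (intro \<sigma>_X) auto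
      finally have "\<sigma> i (d j n (X l)) = scale (lam i j ^ n * lam i l) (d j n (X l))"
        using loc.d_linear Xl by (simp add: K_linear_on_def)
      then show ?thesis
        using iso sub[OF loc.d_closed[OF Xl, of n]]
        by (simp add: Dn alg_iso_def K_linear_on_def mult_ac)
    qed
    then have y_D: "y i * \<psi> (?D n) = scale (lam i j ^ n * lam i l) (\<psi> (?D n)) * y i" for n
      using y_\<psi>[OF 3(2) i(2) D[of n]] A_j_subset[OF D[of n]] by (simp add: inv_scale)
    have "y i * y j = scale (lam i j) (y j * y i)" using inv_comm[of i j] 3 i j by simp
    then have "inverse (y j) * (y i * y j) * inverse (y j)
        = scale (lam i j) (inverse (y j) * (y j * y i) * inverse (y j))"
      by (simp only: scale_mult_left[symmetric] scale_mult_right[symmetric])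
    also have "inverse (y j) * (y i * y j) * inverse (y j) = inverse (y j) * y i"
      using inv_y_nonzero by (simp add: mult.assoc)
    also have "inverse (y j) * (y j * y i) = y i"
      using inv_y_nonzero by (simp add: mult.assoc[symmetric])
    finally have "inverse (y j) * y i = scale (lam i j) (y i * inverse (y j))" .
    then have "y i * inverse (y j) = scale (inverse (lam i j)) (inverse (y j) * y i)"
      using lam by simp
    from power_skew_commute(2)[OF this]
    have y_inv: "y i * inverse (y j) ^ n = scale (inverse (lam i j) ^ n) (inverse (y j) ^ n * y i)" for n .
    \<comment> \<open>The factor \<open>lam i j ^ n\<close> cancels against its inverse from passing
      \<open>inverse (y j) ^ n\<close>, so the scalar no longer depends on \<open>n\<close>.\<close>
    have "y i * (scale (loc.coef n) (\<psi> (?D n)) * inverse (y j) ^ n)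
        = scale (lam i l) (scale (loc.coef n) (\<psi> (?D n)) * inverse (y j) ^ n) * y i" for n
    proof -
      have "y i * (scale (loc.coef n) (\<psi> (?D n)) * inverse (y j) ^ n)
          = scale (loc.coef n) (y i * \<psi> (?D n) * inverse (y j) ^ n)"
        by (simp add: mult.assoc flip: scale_mult_left scale_mult_right)
      also have "y i * \<psi> (?D n) * inverse (y j) ^ n
          = scale (lam i j ^ n * lam i l) (\<psi> (?D n)) * (y i * inverse (y j) ^ n)"
        by (simp add: y_D mult.assoc)
      also have "\<dots> = scale (lam i j ^ n * lam i l * inverse (lam i j) ^ n)
          (\<psi> (?D n) * inverse (y j) ^ n * y i)"
        unfolding y_inv scale_mult_scale by (simp add: mult.assoc)
      also have "lam i j ^ n * lam i l * inverse (lam i j) ^ n = lam i l"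
        using lam by (simp add: power_inverse)
      finally show ?thesis
        by (simp add: mult.commute flip: scale_mult_left)
    qed
    moreover obtain B where "\<forall>n\<ge>B. d j n (X l) = 0" using loc.bound_exists[OF Xl] by blast
    then have \<Theta>: "loc.\<Theta> (X l)
        = (\<Sum>n<B. scale (loc.coef n) (\<psi> (?D n)) * inverse (y j) ^ n)"
      by (intro loc.\<Theta>_eq Xl) auto
    ultimately have "y i * loc.\<Theta> (X l) = scale (lam i l) (loc.\<Theta> (X l)) * y i"
      by (simp add: \<Theta> sum_distrib_left sum_distrib_right scale_sum_right)
    then show ?thesis using 3 l by (simp add: z_eq_y z_eq_\<Theta> scale_mult_left)
  qed
qed

text \<open>A relation is cleared of negative powers of \<open>y j\<close> by a large power \<open>y j ^ M\<close> on the right. It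
  then comes from \<open>A j\<close>, where the top coefficients in \<open>X j\<close> are the original ones, as
  \<open>\<Theta> r = \<psi> r + (negative powers)\<close>.\<close>

lemma z_independent:
  "left_independent (A (j - 1)) loc.\<Theta> (ordered_monomial z j) {s. length s = N + 1 - j}"
  unfolding left_independent_def
proof (intro allI impI)
  fix S :: "nat list set" and r
  assume fin: "finite S" and len: "S \<subseteq> {s. length s = N + 1 - j}" and r: "r ` S \<subseteq> A (j - 1)"
    and eq: "(\<Sum>s\<in>S. loc.\<Theta> (r s) * ordered_monomial z j s) = 0"
  let ?m = "ordered_monomial y"
  have z_y: "ordered_monomial z j s = ?m j s" for s
    by (intro ordered_monomial_cong z_eq_y)
  have Cons: "s = hd s # tl s" if "s \<in> S" for s
    using that len j by (cases s) auto
  have "\<forall>s\<in>S. \<forall>\<^sub>F n in sequentially. \<forall>k\<ge>n. d j k (r s) = 0"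
  proof
    fix s assume "s \<in> S"
    then obtain B where "\<forall>k\<ge>B. d j k (r s) = 0" using r loc.bound_exists by blast
    then show "\<forall>\<^sub>F n in sequentially. \<forall>k\<ge>n. d j k (r s) = 0"
      unfolding eventually_sequentially by (meson order_trans)
  qed
  \<comment> \<open>Finiteness of \<open>S\<close> gives one nilpotency bound for all coefficients.
    Positivity ensures that \<open>n = 0\<close>, which carries the original coefficients, lies in
    the range \<open>n < M\<close>.\<close>
  then have "\<forall>\<^sub>F n in sequentially. (\<forall>s\<in>S. \<forall>k\<ge>n. d j k (r s) = 0) \<and> 0 < n"
    using fin by (intro eventually_conj eventually_ball_finite eventually_gt_at_top) auto
  then obtain M where M: "\<And>s k. s \<in> S \<Longrightarrow> k \<ge> M \<Longrightarrow> d j k (r s) = 0" "0 < M"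
    unfolding eventually_sequentially by blast
  have "\<exists>c. c \<noteq> 0 \<and> ?m j s * y j ^ M = scale c (y j ^ M * ?m j s)" if s: "s \<in> S" for s
  proof (rule ordered_monomial_skew_commute)
    fix i assume i: "j \<le> i" "i < j + length s"
    show "\<exists>c. c \<noteq> 0 \<and> y i * y j ^ M = scale c (y j ^ M * y i)"
    proof (cases "i = j")
      case True
      then show ?thesis by (intro exI[of _ 1]) (simp add: power_commutes)
    next
      case False
      then have i': "j < i" "i \<le> N" using i s len j by auto
      have "lam i j \<noteq> 0" using i' j by (intro lam_nonzero) auto
      moreover have "y i * y j = scale (lam i j) (y j * y i)" using inv_comm[OF i', of j] i' j by simp
      ultimately show ?thesis
        using power_skew_commute(2) by (intro exI[of _ "lam i j ^ M"]) auto
    qed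
  qed
  then obtain \<gamma> where \<gamma>: "\<And>s. s \<in> S \<Longrightarrow> \<gamma> s \<noteq> 0"
    "\<And>s. s \<in> S \<Longrightarrow> ?m j s * y j ^ M = scale (\<gamma> s) (y j ^ M * ?m j s)"
    by metis
  define D where "D s n = scale (\<gamma> s * loc.coef n) (d j n ((loc.\<tau> ^^ n) (r s)))" for s n
  have D: "D s n \<in> A (j - 1)" if "s \<in> S" for s n
    unfolding D_def using that r
    by (intro subalgebraD(4)[OF subalgebra_A] loc.d_closed loc.\<tau>_pow_closed) auto
  \<comment> \<open>For \<open>n < M\<close>, \<open>p s n\<close> is the preimage in
    \<open>A j\<close> of a cleared term with the variables after \<open>y j\<close>
    removed.\<close>
  define p where "p s n = D s n * X j ^ (M - n + hd s)" for s n
  have X_pow: "X j ^ n \<in> A j" for n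
    using j by (intro subalgebra_power subalgebra_A X_in_A) auto
  have p: "p s n \<in> A j" if "s \<in> S" for s n
    unfolding p_def by (intro subalgebraD(3)[OF subalgebra_A] A_j_subset D that X_pow)
  have clear: "loc.\<Theta> (r s) * ?m j s * y j ^ M = (\<Sum>n<M. \<psi> (p s n) * ?m (Suc j) (tl s))" if s: "s \<in> S" for s
  proof -
    have rs: "r s \<in> A (j - 1)" using r s by blast
    have pow: "inverse (y j) ^ n * y j ^ M = y j ^ (M - n)" if "n < M" for n
    proof -
      have "y j ^ M = y j ^ n * y j ^ (M - n)" using that by (simp flip: power_add)
      then show ?thesis using inv_y_nonzero by (simp add: power_inverse mult.assoc[symmetric])
    qed
    have "\<psi> (p s n) = scale (\<gamma> s * loc.coef n) (\<psi> (d j n ((loc.\<tau> ^^ n) (r s)))) * y j ^ (M - n) * y j ^ hd s"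
      for n
    proof -
      have X_k: "\<psi> (X j ^ k) = y j ^ k" for k
        using alg_hom_on_power[OF subalgebra_A inv_hom X_in_A[of j j]] inv_X[of j] j by simp
      moreover have "d j n ((loc.\<tau> ^^ n) (r s)) \<in> A j"
        using rs by (intro A_j_subset loc.d_closed loc.\<tau>_pow_closed)
      ultimately show ?thesis
        unfolding p_def inv_mult[OF A_j_subset[OF D[OF s]] X_pow] X_k
        by (simp add: D_def inv_scale power_add mult.assoc)
    qed
    note \<psi>p = this
    have "loc.\<Theta> (r s) * ?m j s * y j ^ M = loc.\<Theta> (r s) * scale (\<gamma> s) (y j ^ M * ?m j s)"
      by (simp add: \<gamma>(2)[OF s] mult.assoc)
    also have "\<dots> = (\<Sum>n<M. scale (loc.coef n) (\<psi> (d j n ((loc.\<tau> ^^ n) (r s)))) * inverse (y j) ^ n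
        * scale (\<gamma> s) (y j ^ M * ?m j s))"
      by (simp only: loc.\<Theta>_eq[OF rs M(1)[OF s]] sum_distrib_right)
    also have "\<dots> = (\<Sum>n<M. \<psi> (p s n) * ?m (Suc j) (tl s))"
    proof (rule sum.cong[OF refl])
      fix n assume "n \<in> {..<M}"
      then have n: "n < M" by simp
      let ?a = "\<psi> (d j n ((loc.\<tau> ^^ n) (r s)))"
      have "?m j s = y j ^ hd s * ?m (Suc j) (tl s)"
        by (subst Cons[OF s]) simp
      then have "scale (loc.coef n) ?a * inverse (y j) ^ n * scale (\<gamma> s) (y j ^ M * ?m j s)
          = scale (\<gamma> s * loc.coef n) ?a * (inverse (y j) ^ n * y j ^ M) * y j ^ hd s * ?m (Suc j) (tl s)"
        by (simp add: mult.assoc mult.commute[of "\<gamma> s"] flip: scale_mult_left scale_mult_right)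
      then show "scale (loc.coef n) ?a * inverse (y j) ^ n * scale (\<gamma> s) (y j ^ M * ?m j s)
          = \<psi> (p s n) * ?m (Suc j) (tl s)"
        by (simp only: \<psi>p pow[OF n])
    qed
    finally show ?thesis .
  qed
  define I where "I = S \<times> {..<M}"
  have finI: "finite I" using fin by (simp add: I_def)
  have "(\<Sum>i\<in>I. \<psi> (case i of (s, n) \<Rightarrow> p s n) * ?m (Suc j) (tl (fst i)))
      = (\<Sum>s\<in>S. \<Sum>n<M. \<psi> (p s n) * ?m (Suc j) (tl s))"
    unfolding I_def by (simp add: sum.cartesian_product case_prod_beta)
  also have "\<dots> = (\<Sum>s\<in>S. loc.\<Theta> (r s) * ordered_monomial z j s) * y j ^ M"
    by (simp add: clear z_y sum_distrib_right)
  finally have "(\<Sum>i\<in>I. \<psi> (case i of (s, n) \<Rightarrow> p s n) * ?m (Suc j) (tl (fst i))) = 0"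
    by (simp add: eq)
  \<comment> \<open>First comparison, with coefficients in \<open>A j\<close>: monomials in the
    variables after \<open>y j\<close>, that is, tails of exponent lists.\<close>
  then have fib: "(\<Sum>i | i \<in> I \<and> tl (fst i) = s'. case i of (s, n) \<Rightarrow> p s n) = 0" for s'
    using finI len p
    by (intro left_independent_fibre_sum[OF inv_independent])
      (auto simp: inv_add I_def subalgebra_zero subalgebra_A subalgebraD[OF subalgebra_A])
  \<comment> \<open>Second comparison, with coefficients in \<open>A (j - 1)\<close>: powers of
    \<open>X j\<close> in the Ore extension.\<close>
  have top: "(\<Sum>i | i \<in> {i \<in> I. tl (fst i) = s'} \<and> M - snd i + hd (fst i) = t. case i of (s, n) \<Rightarrow> D s n) = 0"
    for s' t
    by (rule left_independent_fibre_sum[OF ore_extension_left_independent[OF ore[OF j]]])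
      (use finI fib[of s'] D in \<open>auto simp: I_def p_def case_prod_beta subalgebra_zero subalgebra_A
        subalgebraD[OF subalgebra_A]\<close>)
  show "\<forall>s\<in>S. r s = 0"
  proof (rule ccontr)
    assume "\<not> (\<forall>s\<in>S. r s = 0)"
    then obtain s1 where s1: "s1 \<in> S" "r s1 \<noteq> 0" by blast
    define T where "T = {s \<in> S. tl s = tl s1 \<and> r s \<noteq> 0}"
    have T: "finite T" "T \<noteq> {}" using fin s1 by (auto simp: T_def)
    \<comment> \<open>With the tail fixed, \<open>s0\<close> has the largest head exponent among
      nonzero coefficients. A pair \<open>(s, n)\<close> with \<open>r s \<noteq> 0\<close> then
      reaches the exponent \<open>M + hd s0\<close> only if \<open>n = 0\<close> and
      \<open>s = s0\<close>.\<close>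
    obtain s0 where s0: "s0 \<in> T" and max: "\<And>s. s \<in> T \<Longrightarrow> hd s \<le> hd s0"
      using T Max_in[of "hd ` T"] Max_ge[of "hd ` T"] by (metis (no_types) finite_imageI imageE image_eqI image_is_empty)
    have s0S: "s0 \<in> S" "tl s0 = tl s1" "r s0 \<noteq> 0" using s0 by (auto simp: T_def)
    let ?J = "{i \<in> {i \<in> I. tl (fst i) = tl s1}. M - snd i + hd (fst i) = M + hd s0}"
    have "(\<Sum>i\<in>?J. case i of (s, n) \<Rightarrow> D s n) = (\<Sum>i\<in>{(s0, 0)}. case i of (s, n) \<Rightarrow> D s n)"
    proof (rule sum.mono_neutral_right)
      show "finite ?J" using finI by simp
      show "{(s0, 0)} \<subseteq> ?J" using s0S M(2) by (auto simp: I_def)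
      show "\<forall>i\<in>?J - {(s0, 0)}. (case i of (s, n) \<Rightarrow> D s n) = 0"
      proof
        fix i assume i: "i \<in> ?J - {(s0, 0)}"
        obtain s n where sn: "i = (s, n)" by (cases i)
        have s: "s \<in> S" "n < M" "tl s = tl s1" "M - n + hd s = M + hd s0" "(s, n) \<noteq> (s0, 0)"
          using i by (auto simp: I_def sn)
        have "r s = 0"
        proof (rule ccontr)
          assume "r s \<noteq> 0"
          then have "hd s \<le> hd s0" using s by (intro max) (auto simp: T_def)
          then have "n = 0" "hd s = hd s0" using s by auto
          moreover have "s = s0" using Cons[OF s(1)] Cons[OF s0S(1)] s(3) s0S(2) \<open>hd s = hd s0\<close> by simp
          ultimately show False using s by simp
        qed
        then have "d j n (r s) = 0" using K_linear_on_zero[OF subalgebra_A loc.d_linear] by simp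
        then have "d j n ((loc.\<tau> ^^ n) (r s)) = 0" using r s by (intro loc.d_\<tau>_eq_0) auto
        then show "(case i of (s, n) \<Rightarrow> D s n) = 0" by (simp add: sn D_def)
      qed
    qed
    then have "D s0 0 = 0" using top[of "tl s1" "M + hd s0"] by simp
    moreover have "r s0 \<in> A (j - 1)" using s0S r by blast
    ultimately show False using s0S \<gamma>(1)[of s0] by (simp add: D_def loc.d_0)
  qed
qed

lemma dd_invariant_step: "dd_invariant j z loc.\<Theta>"
  unfolding dd_invariant_def using loc.\<Theta>_hom z_eq_\<Theta> z_commute z_independent by auto

end

section \<open>The final generators after all steps\<close>

context quantum_nilpotent_in_division_ring
begin

text \<open>The induction descends from \<open>Suc N\<close>. Each step replaces
  \<open>\<psi>\<close> by its own \<open>\<Theta>\<close>, hence the existential.\<close>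

lemma dd_invariant_gens:
  assumes "2 \<le> j" "j \<le> Suc N"
  shows "\<exists>\<psi>. dd_invariant j (dd_gens scale N X \<sigma> q d j) \<psi>"
  using assms(2,1)
proof (induction j rule: inc_induct)
  case base
  have "dd_gens scale N X \<sigma> q d (Suc N) = X" by (subst dd_gens.simps) simp
  then show ?case using dd_invariant_start by auto
next
  case (step j)
  then obtain \<psi> where \<psi>: "dd_invariant (Suc j) (dd_gens scale N X \<sigma> q d (Suc j)) \<psi>" by auto
  interpret deleting_step A scale N X lam \<sigma> \<delta> q d j "dd_gens scale N X \<sigma> q d (Suc j)" \<psi>
    using step \<psi> by unfold_locales auto
  have "dd_gens scale N X \<sigma> q d j = z" using step by (subst dd_gens.simps) simp
  then show ?case using dd_invariant_step by auto
qed

text \<open>At \<open>j = 2\<close> the coefficients still lie in the polynomial ring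
  \<open>A 1\<close>. Comparing tails first and then powers of \<open>X 1\<close> over
  \<open>A 0\<close> brings them down to scalars.\<close>

lemma dd_invariant_2_independent:
  assumes inv: "dd_invariant 2 y \<psi>"
  shows "left_independent (UNIV :: 'k set) (\<lambda>k. scale k 1) (ordered_monomial y 1) {s. length s = N}"
  unfolding left_independent_def
proof (intro allI impI ballI)
  fix S k s0
  assume fin: "finite S" and len: "S \<subseteq> {s. length s = N}" and s0: "s0 \<in> S"
    and eq: "(\<Sum>s\<in>S. scale (k s) 1 * ordered_monomial y 1 s) = 0"
  have hom: "alg_hom_on scale (A 1) \<psi>" and \<psi>X: "\<psi> (X 1) = y 1"
    and ind: "left_independent (A 1) \<psi> (ordered_monomial y (Suc 1)) {s. length s = N - 1}"
    using inv by (auto simp: dd_invariant_def numeral_2_eq_2)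
  have Cons: "s = hd s # tl s" if "s \<in> S" for s
    using that len N_pos by (cases s) auto
  have X_pow: "X 1 ^ n \<in> A 1" for n
    by (intro subalgebra_power subalgebra_A X_in_A) auto
  have "\<psi> (scale (k s) (X 1 ^ hd s)) * ordered_monomial y (Suc 1) (tl s)
      = scale (k s) 1 * ordered_monomial y 1 s" if "s \<in> S" for s
  proof -
    have "\<psi> (scale (k s) (X 1 ^ hd s)) = scale (k s) (y 1 ^ hd s)"
      using hom X_pow alg_hom_on_power[OF subalgebra_A hom X_in_A[of 1 1]] \<psi>X
      by (simp add: alg_hom_on_def K_linear_on_def)
    moreover have "ordered_monomial y 1 s = y 1 ^ hd s * ordered_monomial y (Suc 1) (tl s)"
      by (subst Cons[OF that]) simp
    ultimately show ?thesis by (simp add: scale_mult_left[symmetric])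
  qed
  then have "(\<Sum>s\<in>S. \<psi> (scale (k s) (X 1 ^ hd s)) * ordered_monomial y (Suc 1) (tl s)) = 0"
    using eq by simp
  then have fib: "(\<Sum>s | s \<in> S \<and> tl s = tl s0. scale (k s) (X 1 ^ hd s)) = 0"
    using fin len X_pow hom subalgebraD[OF subalgebra_A]
    by (intro left_independent_fibre_sum[OF ind])
      (auto simp: subalgebra_zero subalgebra_A alg_hom_on_def K_linear_on_def)
  have "(\<Sum>s | s \<in> {s \<in> S. tl s = tl s0} \<and> hd s = hd s0. scale (k s) 1) = 0"
  proof (rule left_independent_fibre_sum[OF ore_extension_left_independent[OF polynomial]])
    show "(\<Sum>s | s \<in> S \<and> tl s = tl s0. scale (k s) 1 * X 1 ^ hd s) = 0"
      using fib by (simp add: scale_mult_left[symmetric])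
  qed (use fin in \<open>auto simp: subalgebra_zero subalgebra_A subalgebraD[OF subalgebra_A]\<close>)
  moreover have "{s. s \<in> {s \<in> S. tl s = tl s0} \<and> hd s = hd s0} = {s0}"
    using s0 Cons by (auto, metis)
  ultimately show "k s0 = 0" by simp
qed

text \<open>The invariant covers \<open>l < i\<close>; the remaining cases use the unit diagonal and
  the antisymmetry of \<open>lam\<close>.\<close>

lemma dd_invariant_2_commute:
  assumes inv: "dd_invariant 2 y \<psi>" and i: "i \<in> {1..N}" and l: "l \<in> {1..N}"
  shows "y i * y l = scale (lam i l) (y l * y i)"
proof -
  have comm: "y i * y l = scale (lam i l) (y l * y i)" if "1 \<le> l" "l < i" "i \<le> N" for i l
    using inv that unfolding dd_invariant_def by auto
  consider "l < i" | "l = i" | "i < l" by linarith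
  then show ?thesis
  proof cases
    case 1
    then show ?thesis using comm i l by simp
  next
    case 2
    then show ?thesis using lam_diag[OF i] by simp
  next
    case 3
    then have "y l * y i = scale (lam l i) (y i * y l)" using comm i l by simp
    then show ?thesis using lam_antisym[OF i l] lam_nonzero[OF l i] by simp
  qed
qed

end

section \<open>Presentation of quantum affine spaces\<close>

lemma sum_single_keys:
  "f = (\<Sum>w\<in>Poly_Mapping.keys f. Poly_Mapping.single w (Poly_Mapping.lookup f w))"
  by (rule poly_mapping_eqI) (simp add: lookup_sum lookup_single when_def in_keys_iff)

lemma free_const_0 [simp]: "free_const 0 = 0" and free_const_1 [simp]: "free_const 1 = 1"
  and free_const_mult: "free_const (a * b) = free_const a * free_const b"
  and free_const_add: "free_const (a + b) = free_const a + free_const b"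
  by (simp_all add: free_const_def mult_single single_add)

lemma free_const_sum: "free_const (sum c I) = (\<Sum>i\<in>I. free_const (c i))"
  by (induction I rule: infinite_finite_induct) (simp_all add: free_const_add)

lemma free_const_commute: "f * free_const c = free_const c * f"
proof -
  have "(\<Sum>w\<in>Poly_Mapping.keys f. Poly_Mapping.single w (Poly_Mapping.lookup f w)) * free_const c
      = free_const c * (\<Sum>w\<in>Poly_Mapping.keys f. Poly_Mapping.single w (Poly_Mapping.lookup f w))"
    by (simp add: free_const_def sum_distrib_left sum_distrib_right mult_single mult.commute)
  then show ?thesis by (simp only: sum_single_keys[symmetric])
qed

lemma free_const_left_commute: "f * (free_const c * g) = free_const c * (f * g)"
  by (metis free_const_commute mult.assoc)

lemma single_word_Cons:
  "Poly_Mapping.single (Free_mon (a # w)) 1 = free_var a * Poly_Mapping.single (Free_mon w) 1"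
  by (simp add: free_var_def mult_single plus_free_mon_def)

lemma free_algebra_closed:
  "0 \<in> free_algebra I" "1 \<in> free_algebra I" "free_const c \<in> free_algebra I"
  "f \<in> free_algebra I \<Longrightarrow> g \<in> free_algebra I \<Longrightarrow> f + g \<in> free_algebra I"
  "f \<in> free_algebra I \<Longrightarrow> g \<in> free_algebra I \<Longrightarrow> f - g \<in> free_algebra I"
  "f \<in> free_algebra I \<Longrightarrow> g \<in> free_algebra I \<Longrightarrow> f * g \<in> free_algebra I"
proof -
  show "f \<in> free_algebra I \<Longrightarrow> g \<in> free_algebra I \<Longrightarrow> f + g \<in> free_algebra I"
    using keys_add[of f g] unfolding free_algebra_def by blast
  show "f \<in> free_algebra I \<Longrightarrow> g \<in> free_algebra I \<Longrightarrow> f - g \<in> free_algebra I"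
    using keys_diff[of f g] unfolding free_algebra_def by blast
  show "f \<in> free_algebra I \<Longrightarrow> g \<in> free_algebra I \<Longrightarrow> f * g \<in> free_algebra I"
    using keys_mult[of f g] unfolding free_algebra_def by (fastforce simp: plus_free_mon_def)
qed (auto simp: free_algebra_def free_const_def zero_free_mon_def single_one[symmetric]
    simp del: single_one split: if_splits)

lemma free_var_closed: "i \<in> I \<Longrightarrow> free_var i \<in> free_algebra I"
  by (simp add: free_algebra_def free_var_def)

lemma free_algebra_power: "f \<in> free_algebra I \<Longrightarrow> f ^ n \<in> free_algebra I"
  by (induction n) (simp_all add: free_algebra_closed)

lemma ordered_monomial_closed:
  "{j..<j + length s} \<subseteq> I \<Longrightarrow> ordered_monomial free_var j s \<in> free_algebra I"
proof (induction s arbitrary: j)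
  case (Cons e s)
  have "j \<in> I" "{Suc j..<Suc j + length s} \<subseteq> I" using Cons.prems by auto
  then show ?case
    using Cons.IH[of "Suc j"] by (simp add: free_algebra_closed free_algebra_power free_var_closed)
qed (simp add: free_algebra_closed)

section \<open>Normal forms modulo the q-commutation relations\<close>

locale quantum_ideal =
  fixes N :: nat and lam :: "nat \<Rightarrow> nat \<Rightarrow> 'k::field" and J :: "(nat, 'k) free_alg set"
  assumes ideal: "two_sided_ideal (free_algebra {1..N}) J"
    and relations: "quantum_relations N lam \<subseteq> J"
begin

abbreviation F where "F \<equiv> free_algebra {1..N}"

definition cong (infix "\<approx>" 50) where "f \<approx> g \<longleftrightarrow> f - g \<in> J"

lemma J_closed:
  "0 \<in> J" "a \<in> J \<Longrightarrow> b \<in> J \<Longrightarrow> a - b \<in> J" "a \<in> J \<Longrightarrow> b \<in> J \<Longrightarrow> a + b \<in> J"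
  "r \<in> F \<Longrightarrow> a \<in> J \<Longrightarrow> r * a \<in> J" "r \<in> F \<Longrightarrow> a \<in> J \<Longrightarrow> a * r \<in> J"
proof -
  show "0 \<in> J" and diff: "a \<in> J \<Longrightarrow> b \<in> J \<Longrightarrow> a - b \<in> J" for a b
    using ideal unfolding two_sided_ideal_def by blast+
  from diff[of 0 b] diff[of a "0 - b"] \<open>0 \<in> J\<close> show "a \<in> J \<Longrightarrow> b \<in> J \<Longrightarrow> a + b \<in> J" by simp
  show "r \<in> F \<Longrightarrow> a \<in> J \<Longrightarrow> r * a \<in> J" "r \<in> F \<Longrightarrow> a \<in> J \<Longrightarrow> a * r \<in> J"
    using ideal unfolding two_sided_ideal_def by blast+
qed

lemma cong_refl: "f \<approx> f"
  by (simp add: cong_def J_closed)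

lemma cong_trans [trans]: "f \<approx> g \<Longrightarrow> g \<approx> h \<Longrightarrow> f \<approx> h"
  unfolding cong_def using J_closed(3)[of "f - g" "g - h"] by simp

lemma cong_left: "r \<in> F \<Longrightarrow> f \<approx> g \<Longrightarrow> r * f \<approx> r * g"
  unfolding cong_def using J_closed(4)[of r "f - g"] by (simp add: right_diff_distrib)

lemma cong_right: "r \<in> F \<Longrightarrow> f \<approx> g \<Longrightarrow> f * r \<approx> g * r"
  unfolding cong_def using J_closed(5)[of r "f - g"] by (simp add: left_diff_distrib)

lemma cong_sum: "(\<And>i. i \<in> I \<Longrightarrow> f i \<approx> g i) \<Longrightarrow> sum f I \<approx> sum g I"
proof (induction I rule: infinite_finite_induct)
  case (insert i I)
  then show ?case
    unfolding cong_def using J_closed(3)[of "f i - g i" "sum f I - sum g I"]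
    by (simp add: algebra_simps)
qed (simp_all add: cong_refl)

lemma cong_var_power:
  assumes "a \<in> {1..N}" "b \<in> {1..N}"
  shows "free_var a * free_var b ^ e \<approx> free_const (lam a b ^ e) * (free_var b ^ e * free_var a)"
proof (induction e)
  case (Suc e)
  let ?V = "free_var :: nat \<Rightarrow> (nat, 'k) free_alg" and ?c = "\<lambda>n. free_const (lam a b ^ n)"
  have V: "?V b \<in> F" "?V b ^ e \<in> F" "free_const (lam a b) \<in> F"
    using assms by (simp_all add: free_algebra_closed free_var_closed free_algebra_power)
  have "?V a * ?V b - free_const (lam a b) * ?V b * ?V a \<in> J"
    using relations assms unfolding quantum_relations_def by blast
  then have "?V a * ?V b \<approx> free_const (lam a b) * ?V b * ?V a" by (simp add: cong_def)
  then have "?V a * ?V b * ?V b ^ e \<approx> free_const (lam a b) * ?V b * ?V a * ?V b ^ e"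
    by (rule cong_right[OF V(2)])
  also have "free_const (lam a b) * ?V b * ?V a * ?V b ^ e
      = free_const (lam a b) * ?V b * (?V a * ?V b ^ e)" by (simp add: mult.assoc)
  also have "\<dots> \<approx> free_const (lam a b) * ?V b * (?c e * (?V b ^ e * ?V a))"
    using V by (intro cong_left Suc free_algebra_closed)
  also have "\<dots> = ?c (Suc e) * (?V b ^ Suc e * ?V a)"
    by (simp add: free_const_mult mult.assoc free_const_left_commute[of "?V b"])
  finally show ?case by (simp add: mult.assoc)
qed (simp add: cong_refl)

text \<open>The letter \<open>a\<close> moves right past the powers of smaller variables, collecting
  a scalar each time, until it raises the exponent in its own slot. The length condition guarantees
  that this slot exists.\<close>

lemma cong_var_ordered_monomial:
  assumes "1 \<le> j" "j \<le> a" "a \<le> N" "length s = N + 1 - j"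
  shows "\<exists>c s'. length s' = N + 1 - j
    \<and> free_var a * ordered_monomial free_var j s \<approx> free_const c * ordered_monomial free_var j s'"
  using assms
proof (induction s arbitrary: j)
  case (Cons e s)
  let ?V = "free_var :: nat \<Rightarrow> (nat, 'k) free_alg"
  show ?case
  proof (cases "a = j")
    case True
    then have "?V a * ordered_monomial ?V j (e # s) = free_const 1 * ordered_monomial ?V j (Suc e # s)"
      by (simp add: mult.assoc)
    then show ?thesis using Cons.prems cong_refl by (metis length_Cons)
  next
    case False
    have "length s = N + 1 - Suc j" using Cons.prems by (auto simp: Suc_diff_le)
    with False obtain c s' where s': "length s' = N + 1 - Suc j"
      "?V a * ordered_monomial ?V (Suc j) s \<approx> free_const c * ordered_monomial ?V (Suc j) s'"
      using Cons.IH[of "Suc j"] Cons.prems by auto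
    let ?m = "ordered_monomial ?V (Suc j)" and ?d = "lam a j ^ e"
    have m: "?m s \<in> F" using Cons.prems by (intro ordered_monomial_closed) auto
    have V: "?V j ^ e \<in> F" using Cons.prems by (intro free_algebra_power free_var_closed) auto
    have "?V a * ordered_monomial ?V j (e # s) = ?V a * ?V j ^ e * ?m s"
      by (simp add: mult.assoc)
    also have "\<dots> \<approx> free_const ?d * (?V j ^ e * ?V a) * ?m s"
      using Cons.prems m by (intro cong_right cong_var_power) auto
    also have "\<dots> = free_const ?d * ?V j ^ e * (?V a * ?m s)" by (simp add: mult.assoc)
    also have "\<dots> \<approx> free_const ?d * ?V j ^ e * (free_const c * ?m s')"
      using V s' by (intro cong_left free_algebra_closed)
    also have "\<dots> = free_const (?d * c) * ordered_monomial ?V j (e # s')"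
      by (simp add: free_const_mult mult.assoc free_const_left_commute[of "?V j ^ e"])
    finally show ?thesis using s' Cons.prems
      by (intro exI[of _ "?d * c"] exI[of _ "e # s'"]) auto
  qed
\<comment> \<open>The empty list is excluded: \<open>j \<le> N\<close> makes the required length
  positive.\<close>
qed auto

text \<open>Insertion sort on words: the tail is put in order first, then its head letter is
  inserted.\<close>

lemma cong_word:
  assumes "set w \<subseteq> {1..N}"
  shows "\<exists>c s. length s = N
    \<and> Poly_Mapping.single (Free_mon w) 1 \<approx> free_const c * ordered_monomial free_var 1 s"
  using assms
proof (induction w)
  case Nil
  have "ordered_monomial (free_var :: nat \<Rightarrow> (nat, 'k) free_alg) j (replicate n 0) = 1" for j n
    by (induction n arbitrary: j) auto
  then show ?case
    by (intro exI[of _ 1] exI[of _ "replicate N 0"]) (simp add: cong_refl flip: zero_free_mon_def)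
next
  case (Cons a w)
  let ?V = "free_var :: nat \<Rightarrow> (nat, 'k) free_alg"
  obtain c s where s: "length s = N"
    "Poly_Mapping.single (Free_mon w) 1 \<approx> free_const c * ordered_monomial ?V 1 s"
    using Cons by auto
  obtain c' s' where s': "length s' = N"
    "?V a * ordered_monomial ?V 1 s \<approx> free_const c' * ordered_monomial ?V 1 s'"
    using cong_var_ordered_monomial[of 1 a s] Cons.prems s(1) by auto
  have "Poly_Mapping.single (Free_mon (a # w)) 1 = ?V a * Poly_Mapping.single (Free_mon w) 1"
    by (rule single_word_Cons)
  also have "\<dots> \<approx> ?V a * (free_const c * ordered_monomial ?V 1 s)"
    using s Cons.prems by (intro cong_left free_var_closed) auto
  also have "\<dots> = free_const c * (?V a * ordered_monomial ?V 1 s)"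
    by (rule free_const_left_commute)
  also have "\<dots> \<approx> free_const c * (free_const c' * ordered_monomial ?V 1 s')"
    using s' by (intro cong_left free_algebra_closed)
  also have "\<dots> = free_const (c * c') * ordered_monomial ?V 1 s'"
    by (simp add: free_const_mult mult.assoc)
  finally show ?case using s' by blast
qed

text \<open>The normal form stays indexed by the words of \<open>f\<close>. Different words may
  share an exponent list, and collecting them is left to the comparison of coefficients.\<close>

lemma cong_ordered_monomials:
  assumes "f \<in> F"
  shows "\<exists>c s. (\<forall>w\<in>Poly_Mapping.keys f. length (s w) = N)
    \<and> f - (\<Sum>w\<in>Poly_Mapping.keys f. free_const (c w) * ordered_monomial free_var 1 (s w)) \<in> J"
proof -
  have "\<exists>c s. length s = N \<and> Poly_Mapping.single w (Poly_Mapping.lookup f w)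
      \<approx> free_const c * ordered_monomial free_var 1 s" if w: "w \<in> Poly_Mapping.keys f" for w
  proof -
    have "set (letters w) \<subseteq> {1..N}" using assms w by (auto simp: free_algebra_def)
    then obtain c s where s: "length s = N"
      "Poly_Mapping.single w 1 \<approx> free_const c * ordered_monomial free_var 1 s"
      using cong_word[of "letters w"] by auto
    have "Poly_Mapping.single w (Poly_Mapping.lookup f w)
        = free_const (Poly_Mapping.lookup f w) * Poly_Mapping.single w 1"
      by (simp add: free_const_def mult_single)
    also have "\<dots> \<approx> free_const (Poly_Mapping.lookup f w) * (free_const c * ordered_monomial free_var 1 s)"
      using s by (intro cong_left free_algebra_closed)
    also have "\<dots> = free_const (Poly_Mapping.lookup f w * c) * ordered_monomial free_var 1 s"
      by (simp add: free_const_mult mult.assoc)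
    finally show ?thesis using s by blast
  qed
  then obtain c s where cs: "\<And>w. w \<in> Poly_Mapping.keys f \<Longrightarrow> length (s w) = N"
    "\<And>w. w \<in> Poly_Mapping.keys f \<Longrightarrow> Poly_Mapping.single w (Poly_Mapping.lookup f w)
      \<approx> free_const (c w) * ordered_monomial free_var 1 (s w)"
    by metis
  have "(\<Sum>w\<in>Poly_Mapping.keys f. Poly_Mapping.single w (Poly_Mapping.lookup f w))
      \<approx> (\<Sum>w\<in>Poly_Mapping.keys f. free_const (c w) * ordered_monomial free_var 1 (s w))"
    by (intro cong_sum cs)
  then show ?thesis using cs(1) unfolding sum_single_keys[symmetric] cong_def by blast
qed

end

section \<open>Evaluation of the free algebra and its kernel\<close>

context K_algebra
begin

lemma free_eval_superset:
  assumes "finite S" "Poly_Mapping.keys f \<subseteq> S"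
  shows "free_eval scale T f
    = (\<Sum>w\<in>S. scale (Poly_Mapping.lookup f w) (prod_list (map T (letters w))))"
  unfolding free_eval_def using assms
  by (intro sum.mono_neutral_left) (auto simp: in_keys_iff)

lemma free_eval_add: "free_eval scale T (f + g) = free_eval scale T f + free_eval scale T g"
proof -
  let ?S = "Poly_Mapping.keys f \<union> Poly_Mapping.keys g"
  have "Poly_Mapping.keys (f + g) \<subseteq> ?S" by (rule keys_add)
  then show ?thesis
    by (simp add: free_eval_superset[of ?S] lookup_add scale_left_distrib sum.distrib)
qed

lemma free_eval_0: "free_eval scale T 0 = 0"
  by (simp add: free_eval_def)

lemma free_eval_diff: "free_eval scale T (f - g) = free_eval scale T f - free_eval scale T g"
  using free_eval_add[of T "f - g" g] by (simp add: algebra_simps)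

lemma free_eval_sum: "free_eval scale T (sum f I) = (\<Sum>i\<in>I. free_eval scale T (f i))"
  by (induction I rule: infinite_finite_induct) (simp_all add: free_eval_add free_eval_0)

lemma free_eval_single:
  "free_eval scale T (Poly_Mapping.single w c) = scale c (prod_list (map T (letters w)))"
  by (subst free_eval_superset[of "{w}"]) auto

text \<open>Expanding both factors into words reduces the claim to concatenation.\<close>

lemma free_eval_mult: "free_eval scale T (f * g) = free_eval scale T f * free_eval scale T g"
proof -
  let ?s = "\<lambda>f :: ('i, 'k) free_alg.
    \<Sum>w\<in>Poly_Mapping.keys f. Poly_Mapping.single w (Poly_Mapping.lookup f w)"
  have "free_eval scale T (?s f * ?s g) = free_eval scale T (?s f) * free_eval scale T (?s g)"
    by (simp add: sum_product free_eval_sum mult_single free_eval_single plus_free_mon_def scale_mult_scale)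
  then show ?thesis by (simp only: sum_single_keys[symmetric])
qed

lemma free_eval_const: "free_eval scale T (free_const c) = scale c 1"
  and free_eval_var: "free_eval scale T (free_var i) = T i"
  by (simp_all add: free_const_def free_var_def free_eval_single zero_free_mon_def)

lemma free_eval_1: "free_eval scale T 1 = 1"
  using free_eval_const[of T 1] by simp

lemma free_eval_ordered_monomial:
  "free_eval scale T (ordered_monomial free_var j s) = ordered_monomial T j s"
proof -
  have "free_eval scale T (f ^ n) = free_eval scale T f ^ n" for f n
    by (induction n) (simp_all add: free_eval_1 free_eval_mult)
  then show ?thesis
    by (induction s arbitrary: j) (simp_all add: free_eval_1 free_eval_mult free_eval_var)
qed

lemma free_eval_image: "free_eval scale T ` free_algebra I = alg_gen scale (T ` I)"
proof
  note alg = subalgebraD[OF subalgebra_alg_gen]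
  have word: "prod_list (map T w) \<in> alg_gen scale (T ` I)" if "set w \<subseteq> I" for w
    using that by (induction w) (auto simp: alg hull_inc)
  show "free_eval scale T ` free_algebra I \<subseteq> alg_gen scale (T ` I)"
    unfolding free_eval_def free_algebra_def
    by (auto intro!: subalgebra_sum[OF subalgebra_alg_gen] alg word)
  have "subalgebra scale (free_eval scale T ` free_algebra I)"
    unfolding subalgebra_def
  proof (intro conjI ballI allI)
    show "1 \<in> free_eval scale T ` free_algebra I"
      by (rule image_eqI[of _ _ 1]) (simp_all add: free_eval_1 free_algebra_closed)
  next
    fix a b assume "a \<in> free_eval scale T ` free_algebra I" "b \<in> free_eval scale T ` free_algebra I"
    then show "a + b \<in> free_eval scale T ` free_algebra I" "a * b \<in> free_eval scale T ` free_algebra I"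
      by (auto simp flip: free_eval_add free_eval_mult simp: free_algebra_closed)
  next
    fix c a assume "a \<in> free_eval scale T ` free_algebra I"
    then obtain f where f: "f \<in> free_algebra I" "a = free_eval scale T f" by blast
    have "scale c a = free_eval scale T (free_const c * f)"
      by (simp add: f free_eval_mult free_eval_const flip: scale_mult_left)
    then show "scale c a \<in> free_eval scale T ` free_algebra I"
      using f by (simp add: free_algebra_closed)
  qed
  moreover have "T ` I \<subseteq> free_eval scale T ` free_algebra I"
    using free_var_closed free_eval_var by (metis image_eqI image_subsetI)
  ultimately show "alg_gen scale (T ` I) \<subseteq> free_eval scale T ` free_algebra I"
    by (intro hull_minimal)
qed

text \<open>An element of the kernel is congruent to a combination of ordered monomials modulo the
  ideal of relations. That combination also evaluates to zero, so independence kills its collected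
  coefficients and the element lies in the ideal.\<close>

theorem quantum_affine_spaceI:
  assumes comm: "\<And>i l. i \<in> {1..N} \<Longrightarrow> l \<in> {1..N} \<Longrightarrow> T i * T l = scale (lam i l) (T l * T i)"
    and indep: "left_independent UNIV (\<lambda>k. scale k 1) (ordered_monomial T 1) {s. length s = N}"
  shows "quantum_affine_space scale N lam T (alg_gen scale (T ` {1..N}))"
proof -
  let ?F = "free_algebra {1..N} :: (nat, 'k) free_alg set"
  let ?K = "{f \<in> ?F. free_eval scale T f = 0}"
  let ?J = "two_sided_ideal ?F hull quantum_relations N lam"
  have rel: "quantum_relations N lam \<subseteq> ?K"
  proof
    fix f assume "f \<in> quantum_relations N lam"
    then obtain i l where il: "i \<in> {1..N}" "l \<in> {1..N}"
      and f: "f = free_var i * free_var l - free_const (lam i l) * free_var l * free_var i"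
      unfolding quantum_relations_def by blast
    have "f \<in> ?F" unfolding f using il by (intro free_algebra_closed free_var_closed)
    moreover have "free_eval scale T f = T i * T l - scale (lam i l) (T l * T i)"
      unfolding f by (simp add: free_eval_diff free_eval_mult free_eval_const free_eval_var
          mult.assoc flip: scale_mult_left)
    ultimately show "f \<in> ?K" using comm[OF il] by simp
  qed
  have K: "two_sided_ideal ?F ?K"
    unfolding two_sided_ideal_def
    by (auto simp: free_algebra_closed free_eval_0 free_eval_diff free_eval_mult)
  have JK: "?J \<subseteq> ?K" using rel K by (rule hull_minimal)
  \<comment> \<open>The hull is an intersection, and an empty one would not lie inside
    \<open>?F\<close>; the kernel is a member of the family, which rules this out.\<close>
  have "two_sided_ideal ?F ?J"
    using JK unfolding two_sided_ideal_def by (auto simp: hull_def)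
  then interpret quantum_ideal N lam ?J
    by unfold_locales (auto intro: hull_inc)
  have "f \<in> ?J" if f: "f \<in> ?K" for f
  proof -
    let ?W = "Poly_Mapping.keys f" and ?m = "ordered_monomial free_var 1 :: _ \<Rightarrow> (nat, 'k) free_alg"
    obtain c s where s: "\<And>w. w \<in> ?W \<Longrightarrow> length (s w) = N"
      and fs: "f - (\<Sum>w\<in>?W. free_const (c w) * ?m (s w)) \<in> ?J"
      using cong_ordered_monomials[of f] f by auto
    have "f - (\<Sum>w\<in>?W. free_const (c w) * ?m (s w)) \<in> ?K"
      using fs JK by blast
    then have "(\<Sum>w\<in>?W. scale (c w) 1 * ordered_monomial T 1 (s w)) = 0"
      using f by (simp add: free_eval_diff free_eval_sum free_eval_mult free_eval_const
          free_eval_ordered_monomial)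
    then have fib: "(\<Sum>w | w \<in> ?W \<and> s w = t. c w) = 0" for t
      by (intro left_independent_fibre_sum[OF indep]) (auto simp: s scale_left_distrib)
    have "(\<Sum>w\<in>?W. free_const (c w) * ?m (s w))
        = (\<Sum>t\<in>s ` ?W. \<Sum>w | w \<in> ?W \<and> s w = t. free_const (c w) * ?m (s w))"
      by (rule sum.image_gen) simp
    also have "\<dots> = (\<Sum>t\<in>s ` ?W. free_const (\<Sum>w | w \<in> ?W \<and> s w = t. c w) * ?m t)"
      unfolding free_const_sum sum_distrib_right by (intro sum.cong) auto
    also have "\<dots> = 0" by (simp only: fib) simp
    finally show "f \<in> ?J" using fs by simp
  qed
  with JK have "?K = ?J" by blast
  then show ?thesis by (simp add: quantum_affine_space_def free_eval_image)
qed

end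

theorem corollary2p5:
  fixes scale :: "'k::field \<Rightarrow> 'd::division_ring \<Rightarrow> 'd"
    and N :: nat
    and X :: "nat \<Rightarrow> 'd"
    and lam :: "nat \<Rightarrow> nat \<Rightarrow> 'k"
    and \<sigma> \<delta> :: "nat \<Rightarrow> 'd \<Rightarrow> 'd"
    and q :: "nat \<Rightarrow> 'k"
    and d :: "nat \<Rightarrow> nat \<Rightarrow> 'd \<Rightarrow> 'd"
  assumes "quantum_nilpotent_algebra scale N X lam \<sigma> \<delta> q d"
    and "is_Frac_of (alg_gen scale (X ` {1..N}))"
  shows "quantum_affine_space scale N lam
           (dd_gens scale N X \<sigma> q d 2) (dd_algebra scale N X \<sigma> q d 2)"
proof -
  interpret quantum_nilpotent_in_division_ring "\<lambda>i. alg_gen scale (X ` {1..i})" scale N X lam \<sigma> \<delta> q d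
    using assms(1) by (simp add: quantum_nilpotent_in_division_ring_def)
  \<comment> \<open>\<open>N_pos\<close> gives \<open>2 \<le> Suc N\<close>. For
    \<open>N = 1\<close> the algorithm makes no step and its generators are still
    \<open>X\<close>.\<close>
  obtain \<psi> where inv: "dd_invariant 2 (dd_gens scale N X \<sigma> q d 2) \<psi>"
    using dd_invariant_gens[of 2] N_pos by auto
  show ?thesis
    unfolding dd_algebra_def
    by (intro quantum_affine_spaceI dd_invariant_2_commute[OF inv] dd_invariant_2_independent[OF inv])
qed

end
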